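(* For the Tzitzeica equation $u_{z\bar z}=e^{-2u}-e^{u}$ (that is, $u_{z\bar z}=-f(u)$ with $f(u)=e^{u}-e^{-2u}$), the complex vector spaces $V_d$ of generating functions of weighted degree $d$ satisfy, for every integer $k\ge 0$, $$V_0\cong\mathbb{C},\qquad V_{6k+1}\cong\mathbb{C},\qquad V_{6k+3}=0,\qquad V_{6k+5}\cong\mathbb{C},$$ and $V_{-d}\cong\overline{V_d}$ for every integer $d\ge 0$.
   Context: Let $f(u)=e^{u}-e^{-2u}$, with derivative $f_u=e^u+2e^{-2u}$. The infinite prolongation $M^{(\infty)}$ is the space with coordinates $(z,u,u_0,u_1,u_2,\dots)$, where $u$ is real and $z,u_0,u_1,\dots$ are complex (on a solution $u(z,\bar z)$, $u_j$ stands for $\partial_z^{j+1}u$). Functions on $M^{(\infty)}$ are smooth complex-valued functions of finitely many of the variables $z,\bar z,u,u_j,\bar u_j$; partial derivatives with respect to $z,\bar z,u_j,\bar u_j$ are Wirtinger derivatives. Set $T^0=f$ and $T^{i+1}=\sum_{j=0}^{i}\binom{i}{j}u_{i-j}\,\partial T^j/\partial u$ for $i\ge0$. Define the complex vector field $$e_{-1}=\frac{\partial}{\partial z}+u_0\frac{\partial}{\partial u}+\sum_{i\ge0}u_{i+1}\frac{\partial}{\partial u_i}-\sum_{i\ge0}\overline{T^{i}}\,\frac{\partial}{\partial\bar u_i},$$ and let $e_{\overline{-1}}$ be its complex conjugate. (These are the total $z$- and $\bar z$-derivatives.) Define the linear operator $\mathcal{E}(P)=e_{\overline{-1}}e_{-1}P+f_uP$.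 A function $P$ has weighted degree $d\in\mathbb{Z}$ if $P\circ F_\lambda=\lambda^dP$ for all $\lambda\in\mathbb{C}$ with $|\lambda|=1$, where $F_\lambda(z,u,u_j)=(\lambda^{-1}z,u,\lambda^{j+1}u_j)$. $V$ is the space of functions $P$ on $M^{(\infty)}$ with $\mathcal{E}(P)=0$, $\partial^2P/\partial u_i\partial\bar u_j=0$ for all $i,j\ge 0$, and $\partial P/\partial u=0$. $V_d\subset V$ is the subspace of elements of weighted degree $d$, and $\overline{V_d}=\{\overline{P}:P\in V_d\}$. *)

theory Defs
  imports "HOL-Analysis.Analysis" "HOL-Library.Function_Algebras"
begin

text \<open>
  The point \<open>(z, u, w)\<close> of the infinite prolongation has jet coordinates \<open>u\<^sub>j = w j\<close>.
\<close>

type_synonym jet = "complex \<times> real \<times> (nat \<Rightarrow> complex)"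

definition jz :: "jet \<Rightarrow> complex" where "jz p = fst p"
definition ju :: "jet \<Rightarrow> real" where "ju p = fst (snd p)"
definition jw :: "nat \<Rightarrow> jet \<Rightarrow> complex" where "jw j p = snd (snd p) j"

definition conj_fun :: "(jet \<Rightarrow> complex) \<Rightarrow> jet \<Rightarrow> complex" where
  "conj_fun P = (\<lambda>p. cnj (P p))"


datatype coord = Re_z | Im_z | U | Re_u nat | Im_u nat

primrec shift :: "coord \<Rightarrow> real \<Rightarrow> jet \<Rightarrow> jet" where
  "shift Re_z t p = (fst p + of_real t, snd p)"
| "shift Im_z t p = (fst p + \<i> * of_real t, snd p)"
| "shift U t p = (fst p, fst (snd p) + t, snd (snd p))"
| "shift (Re_u j) t p = (fst p, fst (snd p), (snd (snd p))(j := snd (snd p) j + of_real t))"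
| "shift (Im_u j) t p = (fst p, fst (snd p), (snd (snd p))(j := snd (snd p) j + \<i> * of_real t))"

definition pd :: "coord \<Rightarrow> (jet \<Rightarrow> complex) \<Rightarrow> jet \<Rightarrow> complex" where
  "pd c P = (\<lambda>p. vector_derivative (\<lambda>t. P (shift c t p)) (at 0))"

definition finitely_many_vars :: "(jet \<Rightarrow> complex) \<Rightarrow> bool" where
  "finitely_many_vars P \<longleftrightarrow>
    (\<exists>n. \<forall>p q. jz p = jz q \<longrightarrow> ju p = ju q \<longrightarrow> (\<forall>j<n. jw j p = jw j q) \<longrightarrow> P p = P q)"

text \<open>
  Smoothness is existence and continuity of all iterated real partial derivatives.  Continuity
  refers to the product topology on \<^typ>\<open>jet\<close>; for a function of finitely many of the variables
  this is ordinary continuity in these variables.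
\<close>

definition smooth_fun :: "(jet \<Rightarrow> complex) \<Rightarrow> bool" where
  "smooth_fun P \<longleftrightarrow> finitely_many_vars P \<and>
    (\<forall>cs. continuous_on UNIV (foldr pd cs P) \<and>
      (\<forall>c p. (\<lambda>t. foldr pd cs P (shift c t p)) differentiable (at 0)))"

definition D_z :: "(jet \<Rightarrow> complex) \<Rightarrow> jet \<Rightarrow> complex" where
  "D_z P = (\<lambda>p. (pd Re_z P p - \<i> * pd Im_z P p) / 2)"

definition D_u :: "nat \<Rightarrow> (jet \<Rightarrow> complex) \<Rightarrow> jet \<Rightarrow> complex" where
  "D_u j P = (\<lambda>p. (pd (Re_u j) P p - \<i> * pd (Im_u j) P p) / 2)"

definition D_ubar :: "nat \<Rightarrow> (jet \<Rightarrow> complex) \<Rightarrow> jet \<Rightarrow> complex" where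
  "D_ubar j P = (\<lambda>p. (pd (Re_u j) P p + \<i> * pd (Im_u j) P p) / 2)"


definition f :: "real \<Rightarrow> real" where
  "f u = exp u - exp (- 2 * u)"

definition f_u :: "real \<Rightarrow> real" where
  "f_u u = exp u + 2 * exp (- 2 * u)"

lemma f_u_derivative: "(f has_real_derivative f_u u) (at u)"
  unfolding f_def [abs_def] f_u_def by (auto intro!: derivative_eq_intros)

fun T :: "nat \<Rightarrow> jet \<Rightarrow> complex" where
  "T 0 = (\<lambda>p. of_real (f (ju p)))"
| "T (Suc i) = (\<lambda>p. \<Sum>j\<le>i. of_nat (i choose j) * jw (i - j) p * pd U (T j) p)"

text \<open>
  The total \<open>z\<close>-derivative.  On a function of finitely many variables all but finitely many terms
  of the two series vanish.
\<close>

definition e1 :: "(jet \<Rightarrow> complex) \<Rightarrow> jet \<Rightarrow> complex" where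
  "e1 P = (\<lambda>p. D_z P p + jw 0 p * pd U P p
     + (\<Sum>i. jw (Suc i) p * D_u i P p) - (\<Sum>i. cnj (T i p) * D_ubar i P p))"

text \<open>The complex conjugate of a complex vector field \<open>X\<close> sends \<open>P\<close> to the conjugate of the
  \<open>X\<close>-derivative of the conjugate of \<open>P\<close>.\<close>

definition e1bar :: "(jet \<Rightarrow> complex) \<Rightarrow> jet \<Rightarrow> complex" where
  "e1bar P = conj_fun (e1 (conj_fun P))"

definition E_op :: "(jet \<Rightarrow> complex) \<Rightarrow> jet \<Rightarrow> complex" where
  "E_op P = (\<lambda>p. e1bar (e1 P) p + of_real (f_u (ju p)) * P p)"


definition F :: "complex \<Rightarrow> jet \<Rightarrow> jet" where
  "F l p = (inverse l * jz p, ju p, \<lambda>j. l ^ (j + 1) * jw j p)"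

definition weighted_degree :: "int \<Rightarrow> (jet \<Rightarrow> complex) \<Rightarrow> bool" where
  "weighted_degree d P \<longleftrightarrow> (\<forall>l. cmod l = 1 \<longrightarrow> (\<forall>p. P (F l p) = l powi d * P p))"

definition V :: "(jet \<Rightarrow> complex) set" where
  "V = {P. smooth_fun P \<and> (\<forall>p. E_op P p = 0)
         \<and> (\<forall>i j p. D_u i (D_ubar j P) p = 0) \<and> (\<forall>p. pd U P p = 0)}"

definition V_deg :: "int \<Rightarrow> (jet \<Rightarrow> complex) set" where
  "V_deg d = {P \<in> V. weighted_degree d P}"


definition fscale :: "complex \<Rightarrow> (jet \<Rightarrow> complex) \<Rightarrow> jet \<Rightarrow> complex" where
  "fscale c P = (\<lambda>p. c * P p)"

lemma vector_space_fscale: "vector_space fscale"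
  by standard (auto simp: fscale_def fun_eq_iff algebra_simps)

lemma vector_space_complex: "vector_space ((*) :: complex \<Rightarrow> complex \<Rightarrow> complex)"
  by standard (auto simp: algebra_simps)

text \<open>Isomorphism of the linear subspaces \<open>A\<close> and \<open>B\<close> of two ambient complex vector spaces with
  scalar multiplications \<open>s\<close> and \<open>s'\<close>.\<close>

definition lin_iso ::
  "(complex \<Rightarrow> 'a::ab_group_add \<Rightarrow> 'a) \<Rightarrow> (complex \<Rightarrow> 'b::ab_group_add \<Rightarrow> 'b) \<Rightarrow> 'a set \<Rightarrow> 'b set \<Rightarrow> bool" where
  "lin_iso s s' A B \<longleftrightarrow> module.subspace s A \<and> module.subspace s' B \<and>
     (\<exists>\<phi>. bij_betw \<phi> A B \<and> (\<forall>x\<in>A. \<forall>y\<in>A. \<phi> (x + y) = \<phi> x + \<phi> y)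
        \<and> (\<forall>c. \<forall>x\<in>A. \<phi> (s c x) = s' c (\<phi> x)))"

end

theory Submission imports Defs "HOL-Computational_Algebra.Formal_Power_Series" begin

text \<open>
  Since \<open>\<partial>P/\<partial>u = 0\<close>, the equation \<open>E P = 0\<close> splits into its coefficients of \<open>1\<close>, \<open>e\<^sup>u\<close> and
  \<open>e\<^sup>-\<^sup>2\<^sup>u\<close>.  The first gives that all \<open>P\<^sub>k = \<partial>P/\<partial>u\<^sub>k\<close> are holomorphic in \<open>z\<close>.  The other two give, for
  the highest \<open>n\<close> with \<open>P\<^sub>n \<noteq> 0\<close>, that \<open>P\<^sub>n\<close> is annihilated by the two characteristic vector fields;
  their iterated brackets span all \<open>\<partial>/\<partial>u\<^sub>k\<close>, so \<open>P\<^sub>n\<close> depends on \<open>z\<close> only.  Restricted to the slice where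
  all jet variables vanish, the same equations make each \<open>P\<^sub>k\<close> constant (affine for \<open>k = 0\<close>), so \<open>P\<close> is
  determined by finitely many numbers, and the weighted degree leaves at most one of them.
  In degree \<open>d\<close> divisible by 3 and odd it vanishes too: on second derivatives at the origin the
  equations force \<open>(x + y)\<^sup>d - x\<^sup>d - y\<^sup>d\<close> to be divisible by \<open>x\<^sup>2 + x y + y\<^sup>2\<close>.

  For existence, let \<open>\<psi>\<close> and \<open>\<psi>\<^sup>*\<close> be formal eigenfunctions, with eigenvalue \<open>\<lambda>\<^sup>3\<close>, of the third order
  linear problem of the Tzitzeica equation and of its dual.  Their ratios are series in
  \<open>1/\<lambda>\<close> with polynomial coefficients, and
  \<open>(\<psi>\<^sub>0\<psi>\<^sup>*\<^sub>0 - \<psi>\<^sub>2\<psi>\<^sup>*\<^sub>2) / (\<psi>\<^sub>0\<psi>\<^sup>*\<^sub>0 + \<psi>\<^sub>1\<psi>\<^sup>*\<^sub>1 + \<psi>\<^sub>2\<psi>\<^sup>*\<^sub>2)\<close> solves the linearised equation; its coefficient of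
  \<open>\<lambda>\<^sup>-\<^sup>d\<close> is the generating function of degree \<open>d\<close>.
\<close>

section \<open>Smooth functions of the jet variables\<close>

definition depends_below :: "nat \<Rightarrow> (jet \<Rightarrow> complex) \<Rightarrow> bool" where
  "depends_below n P \<longleftrightarrow>
    (\<forall>p q. jz p = jz q \<longrightarrow> ju p = ju q \<longrightarrow> (\<forall>j<n. jw j p = jw j q) \<longrightarrow> P p = P q)"

lemma finitely_many_vars_iff: "finitely_many_vars P \<longleftrightarrow> (\<exists>n. depends_below n P)"
  unfolding finitely_many_vars_def depends_below_def ..

lemma depends_below_mono: "depends_below n P \<Longrightarrow> n \<le> m \<Longrightarrow> depends_below m P"
  unfolding depends_below_def by (meson less_le_trans)

lemma shift_zero [simp]: "shift c 0 p = p"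
  by (cases c) auto

lemma shift_add: "shift c s (shift c t p) = shift c (s + t) p"
  by (cases c) (auto simp: algebra_simps)

lemma shift_commute: "shift c s (shift d t p) = shift d t (shift c s p)"
  by (cases c; cases d) (auto simp: algebra_simps fun_eq_iff)

lemma depends_below_shift:
  assumes "depends_below n P" "jz p = jz q" "ju p = ju q" "\<forall>j<n. jw j p = jw j q"
  shows "P (shift c t p) = P (shift c t q)"
  using assms(1)[unfolded depends_below_def, rule_format, of "shift c t p" "shift c t q"] assms(2-4)
  by (cases c) (auto simp: jz_def ju_def jw_def)

lemma depends_below_pd:
  assumes "depends_below n P" shows "depends_below n (pd c P)"
  unfolding depends_below_def pd_def
  using depends_below_shift[OF assms] by (metis (no_types, lifting) ext)

lemma smooth_depends: "smooth_fun P \<Longrightarrow> \<exists>n. depends_below n P"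
  by (simp add: smooth_fun_def finitely_many_vars_iff)

lemma smooth_pd [intro]:
  assumes "smooth_fun P" shows "smooth_fun (pd c P)"
proof -
  have "foldr pd cs (pd c P) = foldr pd (cs @ [c]) P" for cs by simp
  then show ?thesis
    using assms depends_below_pd unfolding smooth_fun_def finitely_many_vars_iff by metis
qed

lemma smooth_continuous: "smooth_fun P \<Longrightarrow> continuous_on UNIV P"
  unfolding smooth_fun_def by (metis foldr_Nil id_apply)

lemma smooth_derivative_0:
  assumes "smooth_fun P"
  shows "((\<lambda>t. P (shift c t p)) has_vector_derivative pd c P p) (at 0)"
proof -
  have "(\<lambda>t. foldr pd [] P (shift c t p)) differentiable (at 0)"
    using assms unfolding smooth_fun_def by blast
  then show ?thesis unfolding pd_def by (simp add: vector_derivative_works)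
qed

lemma smooth_derivative:
  assumes "smooth_fun P"
  shows "((\<lambda>t. P (shift c t p)) has_vector_derivative pd c P (shift c s p)) (at s)"
proof -
  have "((\<lambda>t. P (shift c t (shift c s p))) has_vector_derivative pd c P (shift c s p)) (at 0)"
    by (rule smooth_derivative_0[OF assms])
  then have "((\<lambda>t. P (shift c (t + s) p)) has_vector_derivative pd c P (shift c s p)) (at 0)"
    by (simp add: shift_add)
  then show ?thesis
    by (simp add: has_vector_derivative_def has_derivative_at add.commute)
qed

lemma pd_eqI:
  "((\<lambda>t. P (shift c t p)) has_vector_derivative D) (at 0) \<Longrightarrow> pd c P p = D"
  unfolding pd_def by (rule vector_derivative_at)

text \<open>All iterated partial derivatives of a member of \<open>X\<close> stay in
  \<open>X\<close>, so conditions on single functions replace inductions over lists of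
  coordinates.\<close>

lemma smooth_fun_coinduct:
  assumes "P \<in> X"
    and "\<And>P. P \<in> X \<Longrightarrow> finitely_many_vars P"
    and "\<And>P. P \<in> X \<Longrightarrow> continuous_on UNIV P"
    and "\<And>P c p. P \<in> X \<Longrightarrow> (\<lambda>t. P (shift c t p)) differentiable (at 0)"
    and "\<And>P c. P \<in> X \<Longrightarrow> pd c P \<in> X"
  shows "smooth_fun P"
proof -
  have "foldr pd cs P \<in> X" for cs by (induction cs) (simp_all add: assms(1,5))
  then show ?thesis using assms(2-4) unfolding smooth_fun_def by (metis foldr_Nil id_apply)
qed

section \<open>Smoothness of the coordinates and of their algebraic combinations\<close>

lemma continuous_on_jet [continuous_intros]:
  "continuous_on S jz" "continuous_on S ju" "continuous_on S (jw j)"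
proof -
  show "continuous_on S jz" "continuous_on S ju"
    unfolding jz_def [abs_def] ju_def [abs_def] by (intro continuous_intros)+
  have "continuous_on UNIV (\<lambda>p::jet. snd (snd p))"
    by (intro continuous_on_snd continuous_on_id)
  then have "continuous_on UNIV (jw j)"
    unfolding jw_def [abs_def] by (rule continuous_on_product_then_coordinatewise)
  then show "continuous_on S (jw j)" using continuous_on_subset by blast
qed

text \<open>Stable under \<open>pd\<close> by the sum and product rules, hence a witness for
  \<open>smooth_fun_coinduct\<close>. Since \<open>base\<close> admits every smooth function, the
  other rules become closure properties of smoothness.\<close>

inductive_set smooth_closure :: "(jet \<Rightarrow> complex) set" where
  base: "smooth_fun P \<Longrightarrow> P \<in> smooth_closure"
| const: "(\<lambda>p. c) \<in> smooth_closure"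
| jz: "jz \<in> smooth_closure"
| jw: "jw j \<in> smooth_closure"
| exp: "(\<lambda>p. of_real (exp (k * ju p))) \<in> smooth_closure"
| add: "P \<in> smooth_closure \<Longrightarrow> Q \<in> smooth_closure \<Longrightarrow> (\<lambda>p. P p + Q p) \<in> smooth_closure"
| mult: "P \<in> smooth_closure \<Longrightarrow> Q \<in> smooth_closure \<Longrightarrow> (\<lambda>p. P p * Q p) \<in> smooth_closure"
| conj: "P \<in> smooth_closure \<Longrightarrow> (\<lambda>p. cnj (P p)) \<in> smooth_closure"

lemma jz_shift: "jz (shift c t p) = jz p + of_real t * (case c of Re_z \<Rightarrow> 1 | Im_z \<Rightarrow> \<i> | _ \<Rightarrow> 0)"
  by (cases c) (auto simp: jz_def)

lemma ju_shift: "ju (shift c t p) = ju p + t * (case c of U \<Rightarrow> 1 | _ \<Rightarrow> 0)"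
  by (cases c) (auto simp: ju_def)

lemma jw_shift: "jw j (shift c t p) = jw j p + of_real t * (case c of
    Re_u k \<Rightarrow> if k = j then 1 else 0 | Im_u k \<Rightarrow> if k = j then \<i> else 0 | _ \<Rightarrow> 0)"
  by (cases c) (auto simp: jw_def)

lemma jet_derivatives:
  "((\<lambda>t. jz (shift c t p)) has_vector_derivative
      (case c of Re_z \<Rightarrow> 1 | Im_z \<Rightarrow> \<i> | _ \<Rightarrow> 0)) (at 0)"
  "((\<lambda>t. jw j (shift c t p)) has_vector_derivative (case c of
      Re_u k \<Rightarrow> if k = j then 1 else 0 | Im_u k \<Rightarrow> if k = j then \<i> else 0 | _ \<Rightarrow> 0)) (at 0)"
  "((\<lambda>t. complex_of_real (exp (k * ju (shift c t p)))) has_vector_derivative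
      of_real (case c of U \<Rightarrow> k | _ \<Rightarrow> 0) * of_real (exp (k * ju p))) (at 0)"
proof -
  have "((\<lambda>t. exp (k * ju (shift c t p))) has_real_derivative
      (case c of U \<Rightarrow> k | _ \<Rightarrow> 0) * exp (k * ju p)) (at 0)"
    unfolding ju_shift by (auto intro!: derivative_eq_intros split: coord.splits)
  from has_vector_derivative_of_real[OF this]
  show "((\<lambda>t. complex_of_real (exp (k * ju (shift c t p)))) has_vector_derivative
      of_real (case c of U \<Rightarrow> k | _ \<Rightarrow> 0) * of_real (exp (k * ju p))) (at 0)"
    by simp
qed (auto simp: jz_shift jw_shift intro!: derivative_eq_intros)

lemma pd_const: "pd c (\<lambda>p. a) = (\<lambda>p. 0)"
  by (intro ext pd_eqI) (auto intro!: derivative_eq_intros)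

lemma pd_jz: "pd c jz = (\<lambda>p. case c of Re_z \<Rightarrow> 1 | Im_z \<Rightarrow> \<i> | _ \<Rightarrow> 0)"
  by (intro ext pd_eqI jet_derivatives)

lemma pd_jw: "pd c (jw j) = (\<lambda>p. case c of
    Re_u k \<Rightarrow> if k = j then 1 else 0 | Im_u k \<Rightarrow> if k = j then \<i> else 0 | _ \<Rightarrow> 0)"
  by (intro ext pd_eqI jet_derivatives)

lemma pd_exp: "pd c (\<lambda>p. of_real (exp (k * ju p))) =
    (\<lambda>p. of_real (case c of U \<Rightarrow> k | _ \<Rightarrow> 0) * of_real (exp (k * ju p)))"
  by (intro ext pd_eqI jet_derivatives)

lemma smooth_closure_pd:
  "P \<in> smooth_closure \<Longrightarrow> finitely_many_vars P \<and> continuous_on UNIV P \<and>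
    (\<forall>c. pd c P \<in> smooth_closure \<and>
      (\<forall>p. ((\<lambda>t. P (shift c t p)) has_vector_derivative pd c P p) (at 0)))"
proof (induction rule: smooth_closure.induct)
  case (base P)
  then show ?case
    using smooth_closure.base smooth_continuous smooth_derivative_0 smooth_fun_def by blast
next
  case (const a)
  have "((\<lambda>t. a) has_vector_derivative 0) (at 0)" by (auto intro!: derivative_eq_intros)
  then show ?case
    by (auto simp: pd_const finitely_many_vars_def intro: smooth_closure.const)
next
  case jz
  have "finitely_many_vars jz" unfolding finitely_many_vars_def by blast
  then show ?case
    using jet_derivatives(1) by (auto simp: pd_jz intro: smooth_closure.const continuous_intros)
next
  case (jw j)
  have "finitely_many_vars (jw j)" unfolding finitely_many_vars_def by blast
  then show ?case
    using jet_derivatives(2) by (auto simp: pd_jw intro: smooth_closure.const continuous_intros)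
next
  case (exp k)
  have "finitely_many_vars (\<lambda>p. complex_of_real (exp (k * ju p)))"
    unfolding finitely_many_vars_def by auto
  moreover have "pd c (\<lambda>p. complex_of_real (exp (k * ju p))) \<in> smooth_closure" for c
    unfolding pd_exp by (intro smooth_closure.mult smooth_closure.const smooth_closure.exp)
  ultimately show ?case
    using jet_derivatives(3) by (auto simp: pd_exp intro!: continuous_intros)
next
  case (add P Q)
  have *: "((\<lambda>t. P (shift c t p) + Q (shift c t p)) has_vector_derivative
      pd c P p + pd c Q p) (at 0)" for c p
    using add.IH by (intro has_vector_derivative_add) blast+
  then have pd: "pd c (\<lambda>p. P p + Q p) = (\<lambda>p. pd c P p + pd c Q p)" for c
    by (intro ext pd_eqI *)
  obtain n m where "depends_below n P" "depends_below m Q"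
    using add.IH by (auto simp: finitely_many_vars_iff)
  then have "depends_below (max n m) P" "depends_below (max n m) Q"
    by (auto intro: depends_below_mono)
  then have "depends_below (max n m) (\<lambda>p. P p + Q p)"
    unfolding depends_below_def by metis
  then show ?case
    using * add.IH unfolding pd finitely_many_vars_iff
    by (auto intro!: smooth_closure.add continuous_intros)
next
  case (mult P Q)
  have *: "((\<lambda>t. P (shift c t p) * Q (shift c t p)) has_vector_derivative
      P p * pd c Q p + pd c P p * Q p) (at 0)" for c p
    using has_vector_derivative_mult[of "\<lambda>t. P (shift c t p)" "pd c P p" 0 UNIV
      "\<lambda>t. Q (shift c t p)" "pd c Q p"] mult.IH by simp
  then have pd: "pd c (\<lambda>p. P p * Q p) = (\<lambda>p. P p * pd c Q p + pd c P p * Q p)" for c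
    by (intro ext pd_eqI *)
  obtain n m where "depends_below n P" "depends_below m Q"
    using mult.IH by (auto simp: finitely_many_vars_iff)
  then have "depends_below (max n m) P" "depends_below (max n m) Q"
    by (auto intro: depends_below_mono)
  then have "depends_below (max n m) (\<lambda>p. P p * Q p)"
    unfolding depends_below_def by metis
  then show ?case
    using * mult unfolding pd finitely_many_vars_iff
    by (auto intro!: smooth_closure.add smooth_closure.mult continuous_intros)
next
  case (conj P)
  have *: "((\<lambda>t. cnj (P (shift c t p))) has_vector_derivative cnj (pd c P p)) (at 0)" for c p
    using conj.IH by (intro has_vector_derivative_cnj) blast
  then have pd: "pd c (\<lambda>p. cnj (P p)) = (\<lambda>p. cnj (pd c P p))" for c
    by (intro ext pd_eqI *)
  obtain n where "depends_below n P"
    using conj.IH by (auto simp: finitely_many_vars_iff)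
  then have "depends_below n (\<lambda>p. cnj (P p))"
    unfolding depends_below_def by metis
  then show ?case
    using * conj unfolding pd finitely_many_vars_iff
    by (auto intro!: smooth_closure.conj continuous_intros)
qed

lemma smooth_closure_smooth: "P \<in> smooth_closure \<Longrightarrow> smooth_fun P"
  by (rule smooth_fun_coinduct[where X = smooth_closure])
     (use smooth_closure_pd differentiableI_vector in blast)+

lemma pd_add: "smooth_fun P \<Longrightarrow> smooth_fun Q \<Longrightarrow> pd c (\<lambda>p. P p + Q p) = (\<lambda>p. pd c P p + pd c Q p)"
  by (rule ext, rule pd_eqI) (auto intro!: derivative_eq_intros smooth_derivative_0)

lemma pd_mult: "smooth_fun P \<Longrightarrow> smooth_fun Q \<Longrightarrow>
    pd c (\<lambda>p. P p * Q p) = (\<lambda>p. P p * pd c Q p + pd c P p * Q p)"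
  using has_vector_derivative_mult[OF smooth_derivative_0 smooth_derivative_0]
  by (intro ext pd_eqI) fastforce

lemma pd_cnj: "smooth_fun P \<Longrightarrow> pd c (\<lambda>p. cnj (P p)) = (\<lambda>p. cnj (pd c P p))"
  by (rule ext, rule pd_eqI) (auto intro!: derivative_eq_intros smooth_derivative_0)

section \<open>Symmetry of second partial derivatives\<close>

lemma continuous_shift_shift:
  "continuous_on UNIV (\<lambda>x::real \<times> real. shift c (fst x) (shift d (snd x) p))"
proof -
  have eq: "shift c s q = (jz q + of_real s * (case c of Re_z \<Rightarrow> 1 | Im_z \<Rightarrow> \<i> | _ \<Rightarrow> 0),
     ju q + s * (case c of U \<Rightarrow> 1 | _ \<Rightarrow> 0),
     \<lambda>j. jw j q + of_real s * (case c of
    Re_u k \<Rightarrow> if k = j then 1 else 0 | Im_u k \<Rightarrow> if k = j then \<i> else 0 | _ \<Rightarrow> 0))" for c s q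
    by (cases c) (auto simp: jz_def ju_def jw_def fun_eq_iff prod_eq_iff)
  show ?thesis
    unfolding eq[of c] jz_shift ju_shift jw_shift by (intro continuous_intros)
qed
text \<open>By the Leibniz rule the integral of \<open>gts s\<close> over \<open>{t..b}\<close> is
  \<open>gs s b - gs s t\<close>. Differentiating in \<open>b\<close> at the left end
  \<open>t\<close> gives \<open>gts s t\<close> on one side and \<open>gst s t\<close> on the
  other.\<close>

lemma mixed_partials_commute:
  fixes g gs gt gst gts :: "real \<Rightarrow> real \<Rightarrow> complex"
  assumes gs: "\<And>s t. ((\<lambda>s. g s t) has_vector_derivative gs s t) (at s)"
    and gt: "\<And>s t. (g s has_vector_derivative gt s t) (at t)"
    and gst: "\<And>s t. (gs s has_vector_derivative gst s t) (at t)"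
    and gts: "\<And>s t. ((\<lambda>s. gt s t) has_vector_derivative gts s t) (at s)"
    and cont: "continuous_on UNIV (\<lambda>(s, t). gts s t)"
  shows "gst s t = gts s t"
proof -
  have int: "(gt s has_integral g s b - g s t) {t..b}" if "t \<le> b" for s b
    using gt by (intro fundamental_theorem_of_calculus that)
      (auto intro: has_vector_derivative_at_within)
  have cont_s: "continuous_on {t..t+1} (gts s)"
  proof -
    have "continuous_on UNIV (\<lambda>t. case (s, t) of (s, t) \<Rightarrow> gts s t)"
      by (rule continuous_on_compose2[OF cont]) (auto intro!: continuous_intros)
    then show ?thesis by (auto intro: continuous_on_subset)
  qed
  have diff: "integral {t..b} (gts s) = gs s b - gs s t" if "t \<le> b" for b
  proof -
    have "((\<lambda>x. integral (cbox t b) (gt x)) has_vector_derivative integral (cbox t b) (gts s))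
        (at s within UNIV)"
    proof (rule leibniz_rule_vector_derivative)
      show "gt x integrable_on cbox t b" for x
        using int[OF that] by (auto simp: integrable_on_def)
      show "continuous_on (UNIV \<times> cbox t b) (\<lambda>(x, t). gts x t)"
        using cont continuous_on_subset by blast
    qed (use gts in auto)
    moreover have "(\<lambda>x. integral (cbox t b) (gt x)) = (\<lambda>x. g x b - g x t)"
      using int[OF that] by (auto simp: integral_unique)
    moreover have "((\<lambda>x. g x b - g x t) has_vector_derivative gs s b - gs s t) (at s)"
      by (intro has_vector_derivative_diff gs)
    ultimately show ?thesis
      using vector_derivative_unique_at by fastforce
  qed
  have "((\<lambda>b. integral {t..b} (gts s)) has_vector_derivative gts s t) (at t within {t..t+1})"
    by (rule integral_has_vector_derivative[OF cont_s]) auto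
  then have "((\<lambda>b. gs s b - gs s t) has_vector_derivative gts s t) (at t within {t..t+1})"
    by (rule has_vector_derivative_transform_within[OF _ zero_less_one]) (auto simp: diff)
  moreover have "((\<lambda>b. gs s b - gs s t) has_vector_derivative gst s t) (at t within {t..t+1})"
    by (auto intro!: derivative_eq_intros has_vector_derivative_at_within[OF gst])
  ultimately show ?thesis
    using vector_derivative_unique_within_closed_interval[of t "t+1" t] by force
qed

lemma pd_commute:
  assumes "smooth_fun P"
  shows "pd c (pd d P) = pd d (pd c P)"
proof
  fix p
  let ?q = "\<lambda>s t. shift c s (shift d t p)"
  have cont: "continuous_on UNIV (\<lambda>(s, t). Q (?q s t))" if "smooth_fun Q" for Q
  proof -
    have "continuous_on UNIV (\<lambda>x. Q (shift c (fst x) (shift d (snd x) p)))"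
      by (rule continuous_on_compose2[OF smooth_continuous[OF that] continuous_shift_shift]) auto
    then show ?thesis by (simp add: case_prod_unfold)
  qed
  have d: "((\<lambda>t. Q (?q s t)) has_vector_derivative pd d Q (?q s t)) (at t)"
    if "smooth_fun Q" for Q s t
    using smooth_derivative[OF that, of d "shift c s p" t] by (simp add: shift_commute)
  have "pd d (pd c P) (?q 0 0) = pd c (pd d P) (?q 0 0)"
  proof (rule mixed_partials_commute[where g = "\<lambda>s t. P (?q s t)"
        and gs = "\<lambda>s t. pd c P (?q s t)" and gt = "\<lambda>s t. pd d P (?q s t)"
        and gst = "\<lambda>s t. pd d (pd c P) (?q s t)" and gts = "\<lambda>s t. pd c (pd d P) (?q s t)"])
  qed (use assms in \<open>auto intro!: smooth_derivative d cont\<close>)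
  then show "pd c (pd d P) p = pd d (pd c P) p" by simp
qed

section \<open>The differential ring of smooth functions\<close>

text \<open>As a type, the smooth functions form an instance of \<open>comm_ring_1\<close>, which
  opens ring normalisation and formal power series with coefficients in them.\<close>

typedef smf = "{P. smooth_fun P}" morphisms fn Smf
  using smooth_closure_smooth[OF smooth_closure.const] by blast

setup_lifting type_definition_smf

lemma smooth_fun_fn [simp]: "smooth_fun (fn x)"
  using fn by simp

lemmas smooth_intros = smooth_closure.intros[THEN smooth_closure_smooth]

lemma
  smooth_add: "smooth_fun P \<Longrightarrow> smooth_fun Q \<Longrightarrow> smooth_fun (\<lambda>p. P p + Q p)" and
  smooth_mult: "smooth_fun P \<Longrightarrow> smooth_fun Q \<Longrightarrow> smooth_fun (\<lambda>p. P p * Q p)" and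
  smooth_cnj: "smooth_fun P \<Longrightarrow> smooth_fun (\<lambda>p. cnj (P p))" and
  smooth_uminus: "smooth_fun P \<Longrightarrow> smooth_fun (\<lambda>p. - P p)" and
  smooth_diff: "smooth_fun P \<Longrightarrow> smooth_fun Q \<Longrightarrow> smooth_fun (\<lambda>p. P p - Q p)"
proof -
  show add: "smooth_fun (\<lambda>p. P p + Q p)" if "smooth_fun P" "smooth_fun Q" for P Q
    using that by (intro smooth_intros(6) smooth_closure.base)
  show "smooth_fun (\<lambda>p. P p * Q p)" if "smooth_fun P" "smooth_fun Q" for P Q
    using that by (intro smooth_intros(7) smooth_closure.base)
  show "smooth_fun (\<lambda>p. cnj (P p))" if "smooth_fun P" for P
    using that by (intro smooth_intros(8) smooth_closure.base)
  show neg: "smooth_fun (\<lambda>p. - P p)" if "smooth_fun P" for P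
    using smooth_intros(7)[OF smooth_closure.const[of "-1"] smooth_closure.base[OF that]] by simp
  show "smooth_fun (\<lambda>p. P p - Q p)" if "smooth_fun P" "smooth_fun Q" for P Q
    using add[OF that(1) neg[OF that(2)]] by simp
qed

instantiation smf :: comm_ring_1
begin

lift_definition zero_smf :: smf is "\<lambda>p. 0" by (rule smooth_intros)
lift_definition one_smf :: smf is "\<lambda>p. 1" by (rule smooth_intros)
lift_definition plus_smf :: "smf \<Rightarrow> smf \<Rightarrow> smf" is "\<lambda>P Q p. P p + Q p" by (rule smooth_add)
lift_definition minus_smf :: "smf \<Rightarrow> smf \<Rightarrow> smf" is "\<lambda>P Q p. P p - Q p" by (rule smooth_diff)
lift_definition uminus_smf :: "smf \<Rightarrow> smf" is "\<lambda>P p. - P p" by (rule smooth_uminus)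
lift_definition times_smf :: "smf \<Rightarrow> smf \<Rightarrow> smf" is "\<lambda>P Q p. P p * Q p" by (rule smooth_mult)

instance
  by standard (transfer; auto simp: algebra_simps fun_eq_iff)+

end

lift_definition Cn :: "complex \<Rightarrow> smf" is "\<lambda>c p. c" by (rule smooth_intros)
lift_definition Z :: smf is jz by (rule smooth_intros)
lift_definition W :: "nat \<Rightarrow> smf" is jw by (rule smooth_intros)
lift_definition Exu :: "real \<Rightarrow> smf" is "\<lambda>k p. of_real (exp (k * ju p))" by (rule smooth_intros)
lift_definition cj :: "smf \<Rightarrow> smf" is "\<lambda>P p. cnj (P p)" by (rule smooth_cnj)
lift_definition pdr :: "coord \<Rightarrow> smf \<Rightarrow> smf" is pd by (rule smooth_pd)

lemmas fn_simps [simp] = zero_smf.rep_eq one_smf.rep_eq plus_smf.rep_eq minus_smf.rep_eq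
  uminus_smf.rep_eq times_smf.rep_eq Cn.rep_eq Z.rep_eq W.rep_eq Exu.rep_eq cj.rep_eq

lemma smf_eqI: "(\<And>p. fn x p = fn y p) \<Longrightarrow> x = y"
  by (simp add: fn_inject[symmetric] ext)

lemma fn_sum [simp]: "fn (sum g A) p = (\<Sum>i\<in>A. fn (g i) p)"
  by (induction A rule: infinite_finite_induct) auto

lemma fn_of_nat [simp]: "fn (of_nat n) p = of_nat n"
  by (induction n) auto

lemma fn_numeral [simp]: "fn (numeral n) p = numeral n"
  using fn_of_nat[of "numeral n"] by simp

lemma Cn_simps [simp]: "Cn 0 = 0" "Cn 1 = 1" "Cn (numeral n) = numeral n" "Cn (of_nat k) = of_nat k"
  by (auto intro!: smf_eqI)

lemma Cn_hom: "Cn (a + b) = Cn a + Cn b" "Cn (a * b) = Cn a * Cn b" "Cn (- a) = - Cn a"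
  "Cn (a - b) = Cn a - Cn b"
  by (auto intro!: smf_eqI)

text \<open>Smooth functions have zero divisors, so only units are cancelled: nonzero constants
  here, exponentials of u in \<open>Exu_cancel\<close>.\<close>

lemma Cn_cancel: "a \<noteq> 0 \<Longrightarrow> Cn a * x = 0 \<longleftrightarrow> x = 0"
proof
  assume a: "a \<noteq> 0" and "Cn a * x = 0"
  then have "Cn (inverse a) * (Cn a * x) = 0" by simp
  then show "x = 0" using a by (simp add: mult.assoc[symmetric] Cn_hom(2)[symmetric])
qed auto

lemma numeral_cancel: "numeral n * (x :: smf) = 0 \<longleftrightarrow> x = 0"
  using Cn_cancel[of "numeral n" x] by simp

lemma Exu_mult: "Exu a * Exu b = Exu (a + b)"
  by (rule smf_eqI) (simp add: exp_add[symmetric] of_real_mult[symmetric] ring_distribs del: of_real_mult)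

lemma Exu_0 [simp]: "Exu 0 = 1"
  by (rule smf_eqI) simp

lemma Exu_cancel: "Exu a * x = 0 \<longleftrightarrow> x = 0"
proof
  assume "Exu a * x = 0"
  then have "Exu (- a) * (Exu a * x) = 0" by simp
  then show "x = 0" by (simp add: mult.assoc[symmetric] Exu_mult)
qed auto

lemma cj_simps [simp]: "cj (x + y) = cj x + cj y" "cj (x - y) = cj x - cj y" "cj (- x) = - cj x"
  "cj (x * y) = cj x * cj y" "cj (cj x) = x" "cj 0 = 0" "cj 1 = 1" "cj (Cn c) = Cn (cnj c)"
  "cj (Exu k) = Exu k" "cj (numeral n) = numeral n" "cj (of_nat m) = of_nat m"
  by (auto intro!: smf_eqI)

lemma cj_sum [simp]: "cj (sum g A) = (\<Sum>i\<in>A. cj (g i))"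
  by (auto intro!: smf_eqI)

lemma cj_eq_0_iff [simp]: "cj x = 0 \<longleftrightarrow> x = 0"
  by (metis cj_simps(5,6))

section \<open>Derivations and Wirtinger derivatives\<close>

definition derivation :: "(smf \<Rightarrow> smf) \<Rightarrow> bool" where
  "derivation d \<longleftrightarrow> (\<forall>x y. d (x + y) = d x + d y) \<and> (\<forall>x y. d (x * y) = d x * y + x * d y) \<and>
    (\<forall>c. d (Cn c) = 0)"

lemma derivationD:
  assumes "derivation d"
  shows "d (x + y) = d x + d y" "d (x * y) = d x * y + x * d y" "d (Cn c) = 0"
    "d 0 = 0" "d 1 = 0" "d (numeral n) = 0" "d (of_nat k) = 0"
    "d (- x) = - d x" "d (x - y) = d x - d y" "d (sum g A) = (\<Sum>i\<in>A. d (g i))"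
proof -
  show add: "d (x + y) = d x + d y" for x y using assms by (simp add: derivation_def)
  show "d (x * y) = d x * y + x * d y" using assms by (simp add: derivation_def)
  show c: "d (Cn c) = 0" for c using assms by (simp add: derivation_def)
  show z: "d 0 = 0" and "d 1 = 0" "d (numeral n) = 0" "d (of_nat k) = 0"
    using c[of 0] c[of 1] c[of "numeral n"] c[of "of_nat k"] by auto
  show neg: "d (- x) = - d x" for x
    using add[of "- x" x] z by (simp add: eq_neg_iff_add_eq_0)
  show "d (x - y) = d x - d y" using add[of x "- y"] neg by simp
  show "d (sum g A) = (\<Sum>i\<in>A. d (g i))"
    by (induction A rule: infinite_finite_induct) (auto simp: add z)
qed

lemma derivation_pdr: "derivation (pdr c)"
proof -
  have "pdr c (x + y) = pdr c x + pdr c y" for x y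
    by transfer (rule pd_add)
  moreover have "pdr c (x * y) = pdr c x * y + x * pdr c y" for x y
    by transfer (simp add: pd_mult add.commute)
  moreover have "pdr c (Cn a) = 0" for a
    by transfer (rule pd_const)
  ultimately show ?thesis unfolding derivation_def by blast
qed

lemma pdr_commute: "pdr c (pdr d x) = pdr d (pdr c x)"
  by transfer (rule pd_commute)

lemma pdr_cj: "pdr c (cj x) = cj (pdr c x)"
  by transfer (rule pd_cnj)

lemma fn_pdr: "fn (pdr c x) = pd c (fn x)"
  by (rule pdr.rep_eq)

text \<open>With one index type for all Wirtinger derivatives, a vector field is a function from
  indices to coefficients, and conjugation permutes the indices by \<open>bar\<close>.\<close>

datatype wirt = Dz | Dzb | DU | Du nat | Dub nat

primrec wd :: "wirt \<Rightarrow> smf \<Rightarrow> smf" where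
  "wd Dz x = Cn (1/2) * pdr Re_z x - Cn (\<i>/2) * pdr Im_z x"
| "wd Dzb x = Cn (1/2) * pdr Re_z x + Cn (\<i>/2) * pdr Im_z x"
| "wd DU x = pdr U x"
| "wd (Du j) x = Cn (1/2) * pdr (Re_u j) x - Cn (\<i>/2) * pdr (Im_u j) x"
| "wd (Dub j) x = Cn (1/2) * pdr (Re_u j) x + Cn (\<i>/2) * pdr (Im_u j) x"

primrec bar :: "wirt \<Rightarrow> wirt" where
  "bar Dz = Dzb" | "bar Dzb = Dz" | "bar DU = DU" | "bar (Du j) = Dub j" | "bar (Dub j) = Du j"

lemma bar_bar [simp]: "bar (bar i) = i" by (cases i) auto

lemma derivation_wd: "derivation (wd i)"
  using derivation_pdr unfolding derivation_def by (cases i) (simp_all add: algebra_simps)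

lemmas wd_simps [simp] = derivationD[OF derivation_wd]

lemma wd_commute: "wd i (wd j x) = wd j (wd i x)"
  by (cases i; cases j)
     (simp_all add: derivationD[OF derivation_pdr] pdr_commute algebra_simps,
      (simp add: pdr_commute algebra_simps)?)

lemma wd_cj: "wd i (cj x) = cj (wd (bar i) x)"
  by (cases i) (simp_all add: pdr_cj Cn_hom)

lemma cj_wd: "cj (wd i x) = wd (bar i) (cj x)"
  by (simp add: wd_cj)

lemma pdr_W: "pdr c (W j) = Cn (case c of
    Re_u k \<Rightarrow> if k = j then 1 else 0 | Im_u k \<Rightarrow> if k = j then \<i> else 0 | _ \<Rightarrow> 0)"
  by transfer (rule pd_jw)

lemma pdr_Z: "pdr c Z = Cn (case c of Re_z \<Rightarrow> 1 | Im_z \<Rightarrow> \<i> | _ \<Rightarrow> 0)"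
  by transfer (rule pd_jz)

lemma pdr_Exu: "pdr c (Exu k) = Cn (of_real (case c of U \<Rightarrow> k | _ \<Rightarrow> 0)) * Exu k"
  by transfer (rule pd_exp)

lemma wd_W: "wd i (W j) = (if i = Du j then 1 else 0)"
  by (cases i) (auto simp: pdr_W Cn_hom[symmetric])

lemma wd_Z: "wd i Z = (if i = Dz then 1 else 0)"
  by (cases i) (auto simp: pdr_Z Cn_hom[symmetric])

lemma wd_Exu: "wd i (Exu k) = (if i = DU then Cn (of_real k) * Exu k else 0)"
  by (cases i) (auto simp: pdr_Exu)

lemma wd_gens [simp]:
  "wd i (W j) = (if i = Du j then 1 else 0)" "wd i (cj (W j)) = (if i = Dub j then 1 else 0)"
  "wd i Z = (if i = Dz then 1 else 0)" "wd i (cj Z) = (if i = Dzb then 1 else 0)"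
  "wd i (Exu k) = (if i = DU then Cn (of_real k) * Exu k else 0)"
  by (cases i; auto simp: wd_W wd_Z wd_Exu wd_cj simp del: wd.simps)+

declare wd.simps [simp del]

section \<open>Vector fields with infinitely many components\<close>

definition supp :: "smf \<Rightarrow> wirt set" where "supp x = {i. wd i x \<noteq> 0}"

text \<open>Infinitely many coefficients may be nonzero; the sum is finite because each function
  depends on finitely many variables.\<close>

definition vf :: "(wirt \<Rightarrow> smf) \<Rightarrow> smf \<Rightarrow> smf" where
  "vf a x = (\<Sum>i\<in>supp x. a i * wd i x)"

lemma depends_below_pd_0:
  assumes "depends_below n P" "n \<le> j" "c \<in> {Re_u j, Im_u j}"
  shows "pd c P = (\<lambda>p. 0)"
proof
  fix p
  have "P (shift c t p) = P p" for t
    using assms unfolding depends_below_def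
    by (intro assms(1)[unfolded depends_below_def, rule_format])
       (auto simp: jz_def ju_def jw_def)
  then show "pd c P p = 0" by (intro pd_eqI) (auto intro!: derivative_eq_intros)
qed

lemma wd_eventually_0:
  obtains n where "\<And>j. j \<ge> n \<Longrightarrow> wd (Du j) x = 0" "\<And>j. j \<ge> n \<Longrightarrow> wd (Dub j) x = 0"
proof -
  obtain n where n: "depends_below n (fn x)" using smooth_depends smooth_fun_fn by blast
  have "pdr (Re_u j) x = 0" "pdr (Im_u j) x = 0" if "j \<ge> n" for j
    using depends_below_pd_0[OF n that] by (auto intro!: smf_eqI simp: fn_pdr)
  then show ?thesis using that[of n] by (simp add: wd.simps)
qed

lemma finite_supp: "finite (supp x)"
proof -
  obtain n where n: "\<And>j. j \<ge> n \<Longrightarrow> wd (Du j) x = 0" "\<And>j. j \<ge> n \<Longrightarrow> wd (Dub j) x = 0"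
    using wd_eventually_0 by blast
  then have "j < n" if "wd (Du j) x \<noteq> 0 \<or> wd (Dub j) x \<noteq> 0" for j
    using that by (meson not_le)
  then have "i \<in> {Dz, Dzb, DU} \<union> Du ` {..<n} \<union> Dub ` {..<n}" if "i \<in> supp x" for i
    using that by (cases i) (simp_all add: supp_def)
  then show ?thesis
    by (rule finite_subset[OF subsetI]) auto
qed

lemma vf_eq: "finite J \<Longrightarrow> supp x \<subseteq> J \<Longrightarrow> vf a x = (\<Sum>i\<in>J. a i * wd i x)"
  unfolding vf_def by (rule sum.mono_neutral_left) (auto simp: supp_def)

lemma derivation_vf: "derivation (vf a)"
proof -
  have "vf a (x + y) = vf a x + vf a y" for x y
  proof -
    let ?J = "supp x \<union> supp y \<union> supp (x + y)"
    have "finite ?J" by (simp add: finite_supp)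
    note eq = vf_eq[OF this]
    have "vf a (x + y) = (\<Sum>i\<in>?J. a i * wd i x + a i * wd i y)"
      by (subst eq) (auto simp: distrib_left)
    also have "\<dots> = vf a x + vf a y"
      by (subst (1 2) eq) (auto simp: sum.distrib)
    finally show ?thesis .
  qed
  moreover have "vf a (x * y) = vf a x * y + x * vf a y" for x y
  proof -
    let ?J = "supp x \<union> supp y \<union> supp (x * y)"
    have "finite ?J" by (simp add: finite_supp)
    note eq = vf_eq[OF this]
    have "vf a (x * y) = (\<Sum>i\<in>?J. a i * wd i x * y + x * (a i * wd i y))"
      by (subst eq) (auto intro!: sum.cong simp: algebra_simps)
    also have "\<dots> = vf a x * y + x * vf a y"
      by (subst (1 2) eq) (auto simp: sum.distrib sum_distrib_left sum_distrib_right)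
    finally show ?thesis .
  qed
  moreover have "vf a (Cn c) = 0" for c by (simp add: vf_def)
  ultimately show ?thesis unfolding derivation_def by blast
qed

lemmas vf_simps [simp] = derivationD[OF derivation_vf]

lemma vf_cong: "(\<And>i. wd i x \<noteq> 0 \<Longrightarrow> a i = b i) \<Longrightarrow> vf a x = vf b x"
  unfolding vf_def by (rule sum.cong) (auto simp: supp_def)

lemma vf_eq_0: "(\<And>i. a i = 0 \<or> wd i x = 0) \<Longrightarrow> vf a x = 0"
  unfolding vf_def by (rule sum.neutral) (metis mult_zero_left mult_zero_right)

lemma vf_coeff: "vf (\<lambda>i. c * a i) x = c * vf a x" "vf (\<lambda>i. a i + b i) x = vf a x + vf b x"
  "vf (\<lambda>i. a i - b i) x = vf a x - vf b x" "vf (\<lambda>i. - a i) x = - vf a x" "vf (\<lambda>i. 0) x = 0"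
  by (simp_all add: vf_def sum_distrib_left sum.distrib sum_subtractf sum_negf algebra_simps)

lemma vf_single: "(\<And>j. j \<noteq> i \<Longrightarrow> a j = 0 \<or> wd j x = 0) \<Longrightarrow> vf a x = a i * wd i x"
proof -
  assume a: "\<And>j. j \<noteq> i \<Longrightarrow> a j = 0 \<or> wd j x = 0"
  have "vf a x = (\<Sum>j\<in>insert i (supp x). a j * wd j x)"
    by (rule vf_eq) (auto simp: finite_supp)
  also have "\<dots> = (\<Sum>j\<in>{i}. a j * wd j x)"
    by (rule sum.mono_neutral_right) (use a in \<open>auto simp: finite_supp\<close>, metis mult_zero_left mult_zero_right)
  finally show ?thesis by simp
qed

lemma wd_as_vf: "wd i x = vf (\<lambda>j. if j = i then 1 else 0) x"
  by (subst vf_single[of i]) auto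

lemma vf_gens [simp]: "vf a (W j) = a (Du j)" "vf a (cj (W j)) = a (Dub j)" "vf a Z = a Dz"
  "vf a (cj Z) = a Dzb" "vf a (Exu k) = a DU * (Cn (of_real k) * Exu k)"
  by (subst vf_single[of "Du j"] vf_single[of "Dub j"] vf_single[of Dz] vf_single[of Dzb]
      vf_single[of DU], auto; fail)+

lemma supp_wd: "supp (wd i x) \<subseteq> supp x"
  unfolding supp_def by (auto simp: wd_commute[of _ i])

text \<open>The second-order terms of the two compositions agree because partial derivatives
  commute, so the commutator is again a vector field.\<close>

lemma vf_bracket: "vf a (vf b x) - vf b (vf a x) = vf (\<lambda>i. vf a (b i) - vf b (a i)) x"
proof -
  have *: "vf a (vf b x) = vf (\<lambda>i. vf a (b i)) x + (\<Sum>i\<in>supp x. \<Sum>j\<in>supp x. b i * a j * wd i (wd j x))"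
    for a b
  proof -
    have "vf a (wd i x) = (\<Sum>j\<in>supp x. a j * wd i (wd j x))" for i
      by (subst vf_eq[OF finite_supp supp_wd]) (simp add: wd_commute)
    then show ?thesis
      unfolding vf_def[of b x] by (simp add: vf_def[of _ x] sum.distrib sum_distrib_left algebra_simps)
  qed
  have "(\<Sum>i\<in>supp x. \<Sum>j\<in>supp x. b i * a j * wd i (wd j x)) =
      (\<Sum>i\<in>supp x. \<Sum>j\<in>supp x. a i * b j * wd i (wd j x))"
    by (subst sum.swap) (simp add: wd_commute mult.commute mult.left_commute)
  then show ?thesis by (simp add: * vf_coeff)
qed

text \<open>The case of \<open>vf_bracket\<close> in which one field is a coordinate derivative,
  whose coefficients are constant.\<close>

lemma wd_vf: "wd k (vf a x) = vf (\<lambda>i. wd k (a i)) x + vf a (wd k x)"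
proof -
  let ?d = "\<lambda>j. if j = k then 1 else 0 :: smf"
  have "vf a (?d i) = 0" for i by simp
  then have "wd k (vf a x) - vf a (wd k x) = vf (\<lambda>i. wd k (a i)) x"
    using vf_bracket[of ?d a x] unfolding wd_as_vf[symmetric] by simp
  then show ?thesis by (simp add: algebra_simps)
qed

lemma cj_vf: "cj (vf a x) = vf (\<lambda>i. cj (a (bar i))) (cj x)"
proof -
  have "i \<in> bar ` supp x" if "i \<in> supp (cj x)" for i
    using that by (intro image_eqI[of _ _ "bar i"]) (simp_all add: supp_def wd_cj)
  then have "supp (cj x) \<subseteq> bar ` supp x" ..
  then have "vf (\<lambda>i. cj (a (bar i))) (cj x) = (\<Sum>i\<in>bar ` supp x. cj (a (bar i)) * wd i (cj x))"
    by (intro vf_eq) (simp_all add: finite_supp)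
  also have "\<dots> = (\<Sum>i\<in>supp x. cj (a i) * cj (wd i x))"
    by (subst sum.reindex) (simp_all add: inj_on_inverseI[of _ bar] wd_cj)
  finally show ?thesis by (simp add: vf_def)
qed

section \<open>Total derivatives\<close>

lemma binomial_sum_Suc:
  fixes g :: "nat \<Rightarrow> 'a :: comm_ring_1"
  shows "(\<Sum>j\<le>Suc i. of_nat (Suc i choose j) * g j) =
    (\<Sum>j\<le>i. of_nat (i choose j) * g j) + (\<Sum>j\<le>i. of_nat (i choose j) * g (Suc j))"
proof -
  have "(\<Sum>j\<le>Suc i. of_nat (Suc i choose j) * g j) =
      (g 0 + (\<Sum>j\<le>i. of_nat (i choose Suc j) * g (Suc j))) + (\<Sum>j\<le>i. of_nat (i choose j) * g (Suc j))"
    by (subst sum.atMost_Suc_shift) (simp add: sum.distrib algebra_simps)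
  also have "g 0 + (\<Sum>j\<le>i. of_nat (i choose Suc j) * g (Suc j)) =
      (\<Sum>j\<le>Suc i. of_nat (i choose j) * g j)"
    by (subst sum.atMost_Suc_shift) simp
  also have "\<dots> = (\<Sum>j\<le>i. of_nat (i choose j) * g j)"
    by (simp add: binomial_eq_0)
  finally show ?thesis .
qed

text \<open>\<open>bell m i\<close> is exp(-m u) times the \<open>i\<close>-th total z-derivative of
  exp(m u); the recursion is the Leibniz rule applied to the derivative
  \<open>m u_0 exp(m u)\<close>.\<close>

fun bell :: "complex \<Rightarrow> nat \<Rightarrow> smf" where
  "bell m 0 = 1"
| "bell m (Suc i) = Cn m * (\<Sum>j\<le>i. of_nat (i choose j) * (W (i - j) * bell m j))"

declare bell.simps(2) [simp del]

lemma wd_bell_0: "i \<notin> range Du \<Longrightarrow> wd i (bell m j) = 0"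
proof (induction j rule: less_induct)
  case (less j)
  then show ?case
    by (cases j; cases i) (auto simp: bell.simps(2) intro!: sum.neutral)
qed

lemma wd_bell_simps [simp]: "wd Dz (bell m j) = 0" "wd Dzb (bell m j) = 0"
  "wd DU (bell m j) = 0" "wd (Dub i) (bell m j) = 0"
  by (rule wd_bell_0, blast)+

text \<open>\<open>T\<^sup>i\<close> is the \<open>i\<close>-th total derivative of \<open>f\<close>; its two exponential parts have complete Bell
  polynomials as coefficients.\<close>

definition Tm :: "nat \<Rightarrow> smf" where
  "Tm i = Exu 1 * bell 1 i - Exu (-2) * bell (-2) i"

lemma wd_DU_Tm: "wd DU (Tm i) = Exu 1 * bell 1 i + 2 * Exu (-2) * bell (-2) i"
  by (simp add: Tm_def Cn_hom)

text \<open>The u-derivative multiplies the two exponentials by 1 and -2, which are the factors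
  \<open>Cn m\<close> in the recursion of \<open>bell\<close>.\<close>

lemma fn_Tm: "fn (Tm i) = T i"
proof (induction i rule: less_induct)
  case (less i)
  show ?case
  proof (cases i)
    case 0
    then show ?thesis by (auto simp: Tm_def f_def fun_eq_iff)
  next
    case (Suc k)
    have "Tm i = (\<Sum>j\<le>k. of_nat (k choose j) * W (k - j) * wd DU (Tm j))"
      unfolding Suc wd_DU_Tm unfolding Tm_def bell.simps(2)
      by (simp add: sum_distrib_left Cn_hom sum_subtractf[symmetric] sum.distrib[symmetric]
          sum_negf[symmetric] algebra_simps)
    moreover have "fn (wd DU (Tm j)) = pd U (T j)" if "j \<le> k" for j
      using less[of j] that by (simp add: Suc wd.simps fn_pdr)
    ultimately show ?thesis
      by (auto simp: Suc fun_eq_iff mult.assoc intro!: sum.cong)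
  qed
qed

primrec ec :: "wirt \<Rightarrow> smf" where
  "ec Dz = 1" | "ec Dzb = 0" | "ec DU = W 0" | "ec (Du i) = W (Suc i)" | "ec (Dub i) = - cj (Tm i)"

definition e :: "smf \<Rightarrow> smf" where "e = vf ec"
definition eb :: "smf \<Rightarrow> smf" where "eb = vf (\<lambda>i. cj (ec (bar i)))"

lemma derivation_e: "derivation e" and derivation_eb: "derivation eb"
  by (simp_all add: e_def eb_def derivation_vf)

lemmas e_simps [simp] = derivationD[OF derivation_e] derivationD[OF derivation_eb]

lemma e_gens [simp]: "e (W j) = W (Suc j)" "e (cj (W j)) = - cj (Tm j)" "e Z = 1" "e (cj Z) = 0"
  "e (Exu k) = Cn (of_real k) * W 0 * Exu k"
  "eb (W j) = - Tm j" "eb (cj (W j)) = cj (W (Suc j))" "eb Z = 0" "eb (cj Z) = 1"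
  "eb (Exu k) = Cn (of_real k) * cj (W 0) * Exu k"
  by (simp_all add: e_def eb_def)

lemma eb_eq: "eb x = cj (e (cj x))"
  by (simp add: e_def eb_def cj_vf)

lemma e_cj: "e (cj x) = cj (eb x)" "eb (cj x) = cj (e x)"
  by (simp_all add: eb_eq)

text \<open>The product rule for exp(-m u) times a total derivative of exp(m u). On the level of the
  recursion, the two sums from the Leibniz rule are merged by Pascal's rule.\<close>

lemma e_bell: "e (bell m i) = bell m (Suc i) - Cn m * W 0 * bell m i"
proof (induction i rule: less_induct)
  case (less i)
  show ?case
  proof (cases i)
    case 0
    then show ?thesis by (simp add: bell.simps(2))
  next
    case (Suc k)
    let ?b = "bell m"
    let ?c = "\<lambda>j. of_nat (k choose j) :: smf"
    have IH: "e (?b j) = ?b (Suc j) - Cn m * W 0 * ?b j" if "j \<le> k" for j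
      using less[of j] that Suc by simp
    have "e (?b (Suc k)) = Cn m * (\<Sum>j\<le>k. ?c j * (W (Suc (k - j)) * ?b j +
        (W (k - j) * ?b (Suc j) - Cn m * W 0 * (W (k - j) * ?b j))))"
      by (auto simp: bell.simps(2)[of m k] IH algebra_simps intro!: arg_cong[of _ _ "\<lambda>x. Cn m * x"] sum.cong)
    also have "\<dots> = Cn m * ((\<Sum>j\<le>k. ?c j * (W (Suc k - j) * ?b j)) +
        (\<Sum>j\<le>k. ?c j * (W (Suc k - Suc j) * ?b (Suc j)))) - Cn m * W 0 * ?b (Suc k)"
      by (simp add: bell.simps(2)[of m k] Suc_diff_le sum_distrib_left sum.distrib[symmetric]
          sum_subtractf[symmetric] algebra_simps)
    also have "\<dots> = ?b (Suc (Suc k)) - Cn m * W 0 * ?b (Suc k)"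
      unfolding bell.simps(2)[of m "Suc k"] binomial_sum_Suc[of k "\<lambda>j. W (Suc k - j) * ?b j"] ..
    finally show ?thesis by (simp add: Suc)
  qed
qed

lemma e_Tm: "e (Tm i) = Tm (Suc i)"
  by (simp add: Tm_def e_bell Cn_hom algebra_simps)

text \<open>The commutator is a field, so its coefficients decide. In the direction
  \<open>Du i\<close> they cancel by \<open>e_Tm\<close>, in the direction \<open>DU\<close> because
  \<open>Tm 0\<close> is real.\<close>

lemma e_eb_commute: "e (eb x) = eb (e x)"
proof -
  have "e (cj (ec (bar i))) - eb (ec i) = 0" for i
    by (cases i) (simp_all add: e_Tm e_cj, simp add: Tm_def)
  then have "e (eb x) - eb (e x) = 0"
    unfolding e_def eb_def vf_bracket by (simp add: vf_coeff)
  then show ?thesis by simp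
qed

section \<open>Transfer of the given notions to the ring of smooth functions\<close>

lemma conj_fun_fn: "conj_fun (fn x) = fn (cj x)"
  by (simp add: conj_fun_def)

lemma D_fn: "D_z (fn x) = fn (wd Dz x)" "D_u j (fn x) = fn (wd (Du j) x)"
  "D_ubar j (fn x) = fn (wd (Dub j) x)" "pd U (fn x) = fn (wd DU x)"
  by (auto simp: D_z_def D_u_def D_ubar_def wd.simps fn_pdr field_simps fun_eq_iff)

lemma fn_e: "e1 (fn x) = fn (e x)"
proof
  fix p
  obtain n where n: "\<And>j. j \<ge> n \<Longrightarrow> wd (Du j) x = 0" "\<And>j. j \<ge> n \<Longrightarrow> wd (Dub j) x = 0"
    using wd_eventually_0 by blast
  let ?J = "{Dz, Dzb, DU} \<union> (Du ` {..<n} \<union> Dub ` {..<n})"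
  have lt: "j < n" if "wd (Du j) x \<noteq> 0 \<or> wd (Dub j) x \<noteq> 0" for j
    using n that by (meson not_le)
  have "i \<in> ?J" if "i \<in> supp x" for i
    using that lt by (cases i) (simp_all add: supp_def)
  then have "e x = (\<Sum>i\<in>?J. ec i * wd i x)"
    unfolding e_def by (intro vf_eq subsetI) auto
  also have "\<dots> = wd Dz x + W 0 * wd DU x + (\<Sum>j<n. W (Suc j) * wd (Du j) x)
      - (\<Sum>j<n. cj (Tm j) * wd (Dub j) x)"
    by (subst sum.union_disjoint, simp, simp, blast)+
       (simp add: sum.reindex inj_on_def sum_negf)
  finally have "fn (e x) p = fn (wd Dz x) p + jw 0 p * fn (wd DU x) p +
      (\<Sum>j<n. jw (Suc j) p * fn (wd (Du j) x) p) - (\<Sum>j<n. cnj (T j p) * fn (wd (Dub j) x) p)"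
    by (simp add: fn_Tm)
  moreover have "(\<Sum>j. jw (Suc j) p * fn (wd (Du j) x) p) = (\<Sum>j<n. jw (Suc j) p * fn (wd (Du j) x) p)"
    "(\<Sum>j. cnj (T j p) * fn (wd (Dub j) x) p) = (\<Sum>j<n. cnj (T j p) * fn (wd (Dub j) x) p)"
    by (intro suminf_finite; simp add: n)+
  ultimately show "e1 (fn x) p = fn (e x) p"
    by (simp add: e1_def D_fn)
qed

definition Eop :: "smf \<Rightarrow> smf" where
  "Eop x = eb (e x) + (Exu 1 + 2 * Exu (-2)) * x"

lemma fn_Eop: "E_op (fn x) = fn (Eop x)"
proof -
  have "e1bar (fn y) = fn (eb y)" for y
    unfolding e1bar_def conj_fun_fn fn_e eb_eq ..
  then show ?thesis
    by (simp add: E_op_def fn_e Eop_def f_u_def)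
qed

definition Vs :: "smf set" where
  "Vs = {x. Eop x = 0 \<and> (\<forall>i j. wd (Du i) (wd (Dub j) x) = 0) \<and> wd DU x = 0}"

lemma fn_eq_0_iff: "(\<forall>p. fn x p = 0) \<longleftrightarrow> x = 0"
  by (metis smf_eqI zero_smf.rep_eq)

lemma fn_in_V_iff: "fn x \<in> V \<longleftrightarrow> x \<in> Vs"
  unfolding V_def Vs_def mem_Collect_eq fn_Eop D_fn fn_eq_0_iff by simp

lemma V_imp_fn: "P \<in> V \<Longrightarrow> \<exists>x\<in>Vs. P = fn x"
  by (metis (no_types, lifting) CollectD Smf_inverse V_def fn_in_V_iff mem_Collect_eq)

text \<open>Conjugation exchanges \<open>e\<close> and \<open>eb\<close>, which commute, and f_u is
  real; so \<open>Eop\<close> commutes with conjugation.\<close>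

lemma cj_in_Vs: "x \<in> Vs \<Longrightarrow> cj x \<in> Vs"
proof -
  assume x: "x \<in> Vs"
  have "Eop (cj x) = cj (Eop x)"
    by (simp add: Eop_def e_cj e_eb_commute)
  then show "cj x \<in> Vs"
    using x by (simp add: Vs_def wd_cj wd_commute)
qed

lemma add_in_Vs: "x \<in> Vs \<Longrightarrow> y \<in> Vs \<Longrightarrow> x + y \<in> Vs"
proof -
  assume "x \<in> Vs" "y \<in> Vs"
  moreover have "Eop (x + y) = Eop x + Eop y" by (simp add: Eop_def algebra_simps)
  ultimately show ?thesis by (simp add: Vs_def)
qed

lemma scale_in_Vs: "x \<in> Vs \<Longrightarrow> Cn c * x \<in> Vs"
proof -
  assume "x \<in> Vs"
  moreover have "Eop (Cn c * x) = Cn c * Eop x" by (simp add: Eop_def algebra_simps)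
  ultimately show ?thesis by (simp add: Vs_def)
qed

lemma zero_in_Vs: "0 \<in> Vs"
  by (simp add: Vs_def Eop_def)

section \<open>Weighted polynomials and the characteristic vector fields\<close>

text \<open>Weighted homogeneous polynomials in the holomorphic jet variables, \<open>u\<^sub>j\<close> having weight
  \<open>j + 1\<close>; the zero polynomial has every weight.\<close>

inductive hpol :: "nat \<Rightarrow> smf \<Rightarrow> bool" where
  const: "hpol 0 (Cn c)"
| zero: "hpol w 0"
| gen: "hpol (Suc j) (W j)"
| add: "hpol w x \<Longrightarrow> hpol w y \<Longrightarrow> hpol w (x + y)"
| mult: "hpol v x \<Longrightarrow> hpol w y \<Longrightarrow> hpol (v + w) (x * y)"

lemma hpol_scale: "hpol w x \<Longrightarrow> hpol w (Cn c * x)"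
  using hpol.mult[OF hpol.const] by simp

lemma hpol_simps: "hpol w x \<Longrightarrow> hpol w (- x)" "hpol w x \<Longrightarrow> hpol w y \<Longrightarrow> hpol w (x - y)"
  "hpol w x \<Longrightarrow> hpol w (of_nat k * x)" "hpol 0 1"
proof -
  show neg: "hpol w (- x)" if "hpol w x" for x
    using hpol_scale[OF that, of "-1"] by (simp add: Cn_hom)
  show "hpol w (x - y)" if "hpol w x" "hpol w y"
    using hpol.add[OF that(1) neg[OF that(2)]] by simp
  show "hpol w (of_nat k * x)" if "hpol w x"
    using hpol_scale[OF that, of "of_nat k"] by simp
  show "hpol 0 1" using hpol.const[of 1] by simp
qed

lemma hpol_sum: "(\<And>i. i \<in> A \<Longrightarrow> hpol w (g i)) \<Longrightarrow> hpol w (sum g A)"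
  by (induction A rule: infinite_finite_induct) (auto intro: hpol.zero hpol.add)

lemma hpol_mult': "hpol v x \<Longrightarrow> hpol w y \<Longrightarrow> n = v + w \<Longrightarrow> hpol n (x * y)"
  using hpol.mult by blast

text \<open>Weights 0 and 1 are treated together because a product of weight 1 has a constant
  factor.\<close>

lemma hpol_low_weight:
  "hpol w x \<Longrightarrow> (w = 0 \<longrightarrow> (\<exists>c. x = Cn c)) \<and> (w = 1 \<longrightarrow> (\<exists>c. x = Cn c * W 0))"
proof (induction rule: hpol.induct)
  case (zero w)
  have "0 = Cn 0" "0 = Cn 0 * W 0" by simp_all
  then show ?case by blast
next
  case (gen j)
  show ?case by (auto intro!: exI[of _ 1])
next
  case (add w x y)
  have "\<exists>c. x + y = Cn c" if "w = 0"
    using add.IH that by (auto simp: Cn_hom(1)[symmetric])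
  moreover have "\<exists>c. x + y = Cn c * W 0" if "w = 1"
    using add.IH that by (auto simp: Cn_hom(1)[symmetric] distrib_right[symmetric])
  ultimately show ?case by blast
next
  case (mult v x w y)
  have eqs: "Cn a * Cn b = Cn (a * b)" "Cn a * (Cn b * W 0) = Cn (a * b) * W 0"
    "Cn a * W 0 * Cn b = Cn (a * b) * W 0" for a b
    by (simp_all add: Cn_hom algebra_simps)
  have "\<exists>c. x * y = Cn c" if "v = 0" "w = 0"
    using mult.IH that by (auto simp: eqs)
  moreover have "\<exists>c. x * y = Cn c * W 0" if "v = 1 \<and> w = 0 \<or> v = 0 \<and> w = 1"
    using that mult.IH by (elim disjE) (auto simp: eqs)
  ultimately show ?case by (simp add: add_is_1)
qed auto

lemma hpol_1: "hpol 1 x \<Longrightarrow> \<exists>c. x = Cn c * W 0"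
  using hpol_low_weight by blast

lemma wd_hpol_0: "hpol w x \<Longrightarrow> i \<notin> range Du \<Longrightarrow> wd i x = 0"
  by (induction rule: hpol.induct) auto

lemma hpol_e: "hpol w x \<Longrightarrow> hpol (Suc w) (e x)"
proof (induction rule: hpol.induct)
  case (mult v x w y)
  have "hpol (Suc (v + w)) (e x * y)" "hpol (Suc (v + w)) (x * e y)"
    using mult by (auto intro: hpol_mult')
  then show ?case by (simp add: hpol.add)
qed (auto intro: hpol.intros)

lemma hpol_bell: "hpol j (bell m j)"
proof (induction j rule: less_induct)
  case (less j)
  show ?case
  proof (cases j)
    case 0
    then show ?thesis by (simp add: hpol_simps)
  next
    case (Suc k)
    have "hpol (Suc k) (W (k - i) * bell m i)" if "i \<le> k" for i
      using that by (intro hpol_mult'[OF hpol.gen less]) (auto simp: Suc)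
    then show ?thesis
      unfolding Suc bell.simps by (auto intro!: hpol_scale hpol_sum hpol_simps)
  qed
qed

section \<open>Homogeneous vector fields and their brackets\<close>

definition wtd :: "nat \<Rightarrow> (wirt \<Rightarrow> smf) \<Rightarrow> bool" where
  "wtd k a \<longleftrightarrow> (\<forall>j<k. a (Du j) = 0) \<and> (\<forall>j\<ge>k. hpol (j - k) (a (Du j))) \<and>
    (\<forall>i. i \<notin> range Du \<longrightarrow> a i = 0)"

text \<open>The weight drops by \<open>k + 1\<close>: the derivative by u_j lowers it by
  \<open>j + 1\<close>, and its coefficient returns \<open>j - k\<close>.\<close>

lemma hpol_vf:
  assumes "wtd k a"
  shows "hpol w x \<Longrightarrow> (w < Suc k \<longrightarrow> vf a x = 0) \<and> (Suc k \<le> w \<longrightarrow> hpol (w - Suc k) (vf a x))"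
proof (induction rule: hpol.induct)
  case (gen j)
  then show ?case using assms by (auto simp: wtd_def)
next
  case (mult v x w y)
  have "hpol (v + w - Suc k) (vf a x * y)" if "Suc k \<le> v + w"
    using mult that by (cases "Suc k \<le> v") (auto intro: hpol_mult' hpol.zero)
  moreover have "hpol (v + w - Suc k) (x * vf a y)" if "Suc k \<le> v + w"
    using mult that by (cases "Suc k \<le> w") (auto intro: hpol_mult' hpol.zero)
  ultimately show ?case
    using mult.IH by (auto intro: hpol.add)
qed (auto intro: hpol.intros)

lemma hpol_wd: "hpol w x \<Longrightarrow> Suc k \<le> w \<Longrightarrow> hpol (w - Suc k) (wd (Du k) x)"
  and wd_hpol_high: "hpol w x \<Longrightarrow> w < Suc k \<Longrightarrow> wd (Du k) x = 0"
proof -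
  have "wtd k (\<lambda>j. if j = Du k then 1 else 0)"
    by (auto simp: wtd_def intro: hpol.zero hpol_simps)
  from hpol_vf[OF this]
  show "hpol w x \<Longrightarrow> Suc k \<le> w \<Longrightarrow> hpol (w - Suc k) (wd (Du k) x)"
    "hpol w x \<Longrightarrow> w < Suc k \<Longrightarrow> wd (Du k) x = 0"
    unfolding wd_as_vf[symmetric] by blast+
qed

text \<open>For \<open>m\<close> equal to 1 or -2 this is, up to sign, the characteristic field that
  multiplies \<open>Exu m\<close> in \<open>eb\<close>; see \<open>eb_split\<close>.\<close>

primrec alc :: "complex \<Rightarrow> wirt \<Rightarrow> smf" where
  "alc m Dz = 0" | "alc m Dzb = 0" | "alc m DU = 0" | "alc m (Du i) = bell m i" | "alc m (Dub i) = 0"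

lemma alc_0: "i \<notin> range Du \<Longrightarrow> alc m i = 0"
  by (cases i) auto

lemma wtd_alc: "wtd 0 (alc m)"
  by (auto simp: wtd_def hpol_bell alc_0)

text \<open>In the recursion for \<open>bell m (Suc k)\<close> only the summand
  \<open>W k * bell m 0\<close> survives: by weight, \<open>vf c\<close> kills both factors of every
  other summand.\<close>

lemma vf_bell:
  assumes c: "wtd k c" and g: "c (Du k) = Cn g"
  shows "vf c (bell m (Suc k)) = Cn (m * g)"
proof -
  have "vf c (W (k - j) * bell m j) = (if j = 0 then Cn g else 0)" if "j \<le> k" for j
    using c g hpol_vf[OF c hpol_bell[of j m]] that by (auto simp: wtd_def)
  then have "(\<Sum>j\<le>k. of_nat (k choose j) * vf c (W (k - j) * bell m j)) =
      (\<Sum>j\<le>k. if j = 0 then Cn g else 0)"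
    by (intro sum.cong refl) (auto simp del: vf_simps(2))
  then show ?thesis
    by (simp add: bell.simps(2) Cn_hom)
qed

text \<open>At index \<open>Suc k\<close> the first term differentiates \<open>Cn x * W 0\<close> to
  \<open>Cn x\<close>, since \<open>bell m 0 = 1\<close>, and the second gives
  \<open>Cn (m * g)\<close> by \<open>vf_bell\<close>.\<close>

lemma bracket_step:
  assumes c: "wtd k c" and g: "c (Du k) = Cn g" and x: "c (Du (Suc k)) = Cn x * W 0"
  defines "c' \<equiv> \<lambda>m i. vf (alc m) (c i) - vf c (alc m i)"
  shows "wtd (Suc k) (c' m)" "c' m (Du (Suc k)) = Cn (x - m * g)"
proof -
  show "c' m (Du (Suc k)) = Cn (x - m * g)"
    by (simp add: c'_def x vf_bell[OF c g] Cn_hom)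
  have "c' m (Du j) = 0" if "j < Suc k" for j
  proof -
    have "c (Du j) = 0 \<or> c (Du j) = Cn g"
      using c g that unfolding wtd_def by (metis less_SucE)
    then show ?thesis
      using hpol_vf[OF c hpol_bell[of j m]] that by (auto simp: c'_def)
  qed
  moreover have "hpol (j - Suc k) (c' m (Du j))" if "Suc k \<le> j" for j
  proof -
    have "hpol (j - k) (c (Du j))" using c that by (simp add: wtd_def)
    from hpol_vf[OF wtd_alc this, of m] have "hpol (j - Suc k) (vf (alc m) (c (Du j)))"
      using that by simp
    moreover have "hpol (j - Suc k) (vf c (bell m j))"
      using hpol_vf[OF c hpol_bell[of j m]] that by blast
    ultimately show ?thesis by (simp add: c'_def hpol_simps)
  qed
  moreover have "c' m i = 0" if "i \<notin> range Du" for i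
    using c that by (simp add: c'_def wtd_def alc_0)
  ultimately show "wtd (Suc k) (c' m)" unfolding wtd_def by blast
qed

text \<open>Iterated brackets of the two fields \<open>\<Sum>\<^sub>i a\<^sub>i \<partial>/\<partial>u\<^sub>i\<close> span all \<open>\<partial>/\<partial>u\<^sub>k\<close>: bracketing a field that
  starts with \<open>\<gamma> \<partial>/\<partial>u\<^sub>k\<close> with the two of them gives leading coefficients
  \<open>\<xi> - \<gamma>\<close> and \<open>\<xi> + 2\<gamma>\<close>, which do not both vanish.\<close>

lemma triangular_field:
  "\<exists>c g. wtd k c \<and> g \<noteq> 0 \<and> c (Du k) = Cn g \<and>
     (\<forall>x. vf (alc 1) x = 0 \<longrightarrow> vf (alc (-2)) x = 0 \<longrightarrow> vf c x = 0)"
proof (induction k)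
  case 0
  have "wtd 0 (alc 1) \<and> (1 :: complex) \<noteq> 0 \<and> alc 1 (Du 0) = Cn 1"
    by (simp add: wtd_alc)
  then show ?case by blast
next
  case (Suc k)
  then obtain c g where c: "wtd k c" "g \<noteq> 0" "c (Du k) = Cn g"
    and ker: "\<And>x. vf (alc 1) x = 0 \<Longrightarrow> vf (alc (-2)) x = 0 \<Longrightarrow> vf c x = 0" by blast
  have "hpol 1 (c (Du (Suc k)))"
    using c(1) by (auto simp: wtd_def dest!: spec[of _ "Suc k"])
  then obtain x where x: "c (Du (Suc k)) = Cn x * W 0" using hpol_1 by blast
  note step = bracket_step[OF c(1,3) x]
  obtain m where m: "m = 1 \<or> m = -2" "x - m * g \<noteq> 0"
  proof (cases "x = g")
    case True
    then show ?thesis using that[of "-2"] c(2) by simp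
  next
    case False
    then show ?thesis using that[of 1] by simp
  qed
  have "vf (\<lambda>i. vf (alc m) (c i) - vf c (alc m i)) y = 0"
    if y: "vf (alc 1) y = 0" "vf (alc (-2)) y = 0" for y
  proof -
    have "vf c y = 0" "vf (alc m) y = 0" using ker y m(1) by auto
    then show ?thesis unfolding vf_bracket[symmetric] by simp
  qed
  then show ?case using step m(2) by blast
qed

text \<open>Serves for arguments by the highest jet variable: a function has no derivatives beyond
  some index.\<close>

lemma downward_induct:
  assumes "\<And>j. j \<ge> n \<Longrightarrow> Q j" and "\<And>j. (\<And>i. i > j \<Longrightarrow> Q i) \<Longrightarrow> Q j"
  shows "Q (j :: nat)"
proof (induction "n - j" arbitrary: j rule: less_induct)
  case less
  have "Q i" if "i > j" for i
  proof (cases "i \<ge> n")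
    case False
    then show ?thesis using that by (intro less) simp
  qed (rule assms(1))
  then show ?case by (rule assms(2))
qed

text \<open>Once all derivatives above \<open>k\<close> vanish, the field starting at u_k reduces to
  a nonzero constant times the derivative by u_k.\<close>

lemma kernel:
  assumes "vf (alc 1) x = 0" "vf (alc (-2)) x = 0"
  shows "wd (Du j) x = 0"
proof -
  obtain n where n: "\<And>j. j \<ge> n \<Longrightarrow> wd (Du j) x = 0" using wd_eventually_0 by metis
  show ?thesis
  proof (rule downward_induct[OF n])
    fix k assume above: "\<And>i. i > k \<Longrightarrow> wd (Du i) x = 0"
    obtain c g where c: "wtd k c" "g \<noteq> 0" "c (Du k) = Cn g" "vf c x = 0"
      using triangular_field assms by blast
    have "c i = 0 \<or> wd i x = 0" if "i \<noteq> Du k" for i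
    proof (cases "i \<in> range Du")
      case True
      then obtain j where "i = Du j" by blast
      then show ?thesis using that c(1) above by (cases "j < k") (auto simp: wtd_def)
    qed (use c(1) in \<open>simp add: wtd_def\<close>)
    then have "vf c x = Cn g * wd (Du k) x" by (subst vf_single[of "Du k"]) (auto simp: c)
    then show "wd (Du k) x = 0" using c Cn_cancel by simp
  qed
qed

section \<open>Separation of the powers of exp(u)\<close>

definition cb :: "(wirt \<Rightarrow> smf) \<Rightarrow> wirt \<Rightarrow> smf" where "cb a i = cj (a (bar i))"

text \<open>The part of the total derivative whose coefficients are free of u, apart from the
  direction \<open>DU\<close>; the rest of \<open>e\<close> carries the exponentials.\<close>

primrec dtc :: "wirt \<Rightarrow> smf" where
  "dtc Dz = 1" | "dtc Dzb = 0" | "dtc DU = 0" | "dtc (Du i) = W (Suc i)" | "dtc (Dub i) = 0"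

definition DT where "DT = vf dtc"
definition DTb where "DTb = vf (cb dtc)"
definition A where "A m = vf (alc m)"
definition Ab where "Ab m = vf (cb (alc m))"

lemmas DA_derivation = derivation_vf[of dtc, folded DT_def] derivation_vf[of "cb dtc", folded DTb_def]
  derivation_vf[of "alc m" for m, folded A_def] derivation_vf[of "cb (alc m)" for m, folded Ab_def]

lemmas DA_simps [simp] = DA_derivation[THEN derivationD(1)] DA_derivation[THEN derivationD(2)]
  DA_derivation[THEN derivationD(3)] DA_derivation[THEN derivationD(4)]
  DA_derivation[THEN derivationD(8)] DA_derivation[THEN derivationD(9)]

lemma cj_DA: "cj (DT x) = DTb (cj x)" "cj (DTb x) = DT (cj x)" "cj (A m x) = Ab m (cj x)"
  "cj (Ab m x) = A m (cj x)"
  by (simp_all add: DT_def DTb_def A_def Ab_def cj_vf cb_def[abs_def])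

lemma e_split:
  "e x = DT x + W 0 * wd DU x - Exu 1 * Ab 1 x + Exu (-2) * Ab (-2) x"
proof -
  have "ec i = dtc i + W 0 * (if i = DU then 1 else 0) - Exu 1 * cb (alc 1) i
      + Exu (-2) * cb (alc (-2)) i" for i
    by (cases i) (simp_all add: cb_def Tm_def)
  then have "vf ec x = vf (\<lambda>i. dtc i + W 0 * (if i = DU then 1 else 0) - Exu 1 * cb (alc 1) i
      + Exu (-2) * cb (alc (-2)) i) x"
    by (rule vf_cong)
  then show ?thesis
    unfolding vf_coeff by (simp add: e_def DT_def Ab_def wd_as_vf[of DU])
qed

lemma eb_split:
  "eb x = DTb x + cj (W 0) * wd DU x - Exu 1 * A 1 x + Exu (-2) * A (-2) x"
  by (simp add: eb_eq e_split cj_DA wd_cj)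

text \<open>All coordinate derivatives commute with \<open>DT\<close> except those by u_(k+1), whose
  commutator with \<open>DT\<close> is the derivative by u_k. This index shift drives the descents
  below.\<close>

lemma wd_DT:
  "wd Dz (DT x) = DT (wd Dz x)" "wd Dzb (DT x) = DT (wd Dzb x)" "wd DU (DT x) = DT (wd DU x)"
  "wd (Dub j) (DT x) = DT (wd (Dub j) x)"
  "wd (Du 0) (DT x) = DT (wd (Du 0) x)"
  "wd (Du (Suc k)) (DT x) = DT (wd (Du (Suc k)) x) + wd (Du k) x"
proof -
  have *: "(\<And>i. wd k (dtc i) = 0) \<Longrightarrow> wd k (DT x) = DT (wd k x)" for k
    by (simp add: DT_def wd_vf vf_coeff)
  have "wd k (dtc i) = 0" if "k \<notin> range (\<lambda>j. Du (Suc j))" for i k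
    using that by (cases i) auto
  then show "wd Dz (DT x) = DT (wd Dz x)" "wd Dzb (DT x) = DT (wd Dzb x)" "wd DU (DT x) = DT (wd DU x)"
    "wd (Dub j) (DT x) = DT (wd (Dub j) x)" "wd (Du 0) (DT x) = DT (wd (Du 0) x)"
    by (intro *; auto)+
  have "wd (Du (Suc k)) (dtc i) = (if i = Du k then 1 else 0)" for i
    by (cases i) auto
  then show "wd (Du (Suc k)) (DT x) = DT (wd (Du (Suc k)) x) + wd (Du k) x"
    by (simp add: DT_def wd_vf wd_as_vf[of "Du k"])
qed

lemma wd_A: "i \<notin> range Du \<Longrightarrow> wd i (A m x) = A m (wd i x)"
proof -
  assume "i \<notin> range Du"
  then have "wd i (alc m j) = 0" for j by (cases j) (auto simp: wd_bell_0)
  then show ?thesis by (simp add: A_def wd_vf vf_coeff)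
qed

lemma wd_A_simps: "wd Dz (A m x) = A m (wd Dz x)" "wd Dzb (A m x) = A m (wd Dzb x)"
  "wd DU (A m x) = A m (wd DU x)" "wd (Dub j) (A m x) = A m (wd (Dub j) x)"
  by (rule wd_A, blast)+

lemma wd_DTb:
  "wd Dz (DTb x) = DTb (wd Dz x)" "wd Dzb (DTb x) = DTb (wd Dzb x)" "wd DU (DTb x) = DTb (wd DU x)"
  "wd (Du j) (DTb x) = DTb (wd (Du j) x)"
  "wd (Dub 0) (DTb x) = DTb (wd (Dub 0) x)"
  "wd (Dub (Suc k)) (DTb x) = DTb (wd (Dub (Suc k)) x) + wd (Dub k) x"
  using wd_DT[where x = "cj x", THEN arg_cong[of _ _ cj]] by (simp_all add: cj_wd cj_DA)

lemma wd_Ab: "wd Dz (Ab m x) = Ab m (wd Dz x)" "wd Dzb (Ab m x) = Ab m (wd Dzb x)"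
  "wd DU (Ab m x) = Ab m (wd DU x)" "wd (Du j) (Ab m x) = Ab m (wd (Du j) x)"
  using wd_A_simps[where x = "cj x", THEN arg_cong[of _ _ cj]] by (simp_all add: cj_wd cj_DA)

lemma A_eq_0: "(\<And>i. wd (Du i) x = 0) \<Longrightarrow> A m x = 0"
  unfolding A_def by (rule vf_eq_0) (metis alc_0 imageE)

lemma DTb_eq_wd: "(\<And>i. wd (Dub i) x = 0) \<Longrightarrow> DTb x = wd Dzb x"
proof -
  assume "\<And>i. wd (Dub i) x = 0"
  then have "cb dtc j = 0 \<or> wd j x = 0" if "j \<noteq> Dzb" for j
    using that by (cases j) (auto simp: cb_def)
  then show ?thesis
    unfolding DTb_def by (subst vf_single[of Dzb]) (auto simp: cb_def)
qed

text \<open>Differentiation by u multiplies the three terms by 0, 1 and -2, so two differentiations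
  produce a Vandermonde system.\<close>

lemma exp_split:
  assumes "x + Exu 1 * y + Exu (-2) * z = 0" "wd DU x = 0" "wd DU y = 0" "wd DU z = 0"
  shows "x = 0" "y = 0" "z = 0"
proof -
  have 1: "Exu 1 * y - 2 * (Exu (-2) * z) = 0"
    using assms(1)[THEN arg_cong[of _ _ "wd DU"]] assms(2-) by (simp add: Cn_hom mult.assoc)
  have 2: "Exu 1 * y + 4 * (Exu (-2) * z) = 0"
    using 1[THEN arg_cong[of _ _ "wd DU"]] assms(2-) by (simp add: Cn_hom mult.assoc)
  have "6 * (Exu (-2) * z) = 0"
    using arg_cong2[OF 2 1, of minus] by (simp add: algebra_simps)
  then show z: "z = 0" by (simp add: numeral_cancel Exu_cancel)
  with 1 show y: "y = 0" by (simp add: Exu_cancel)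
  show "x = 0" using assms(1) y z by simp
qed

lemma Vs_equations:
  assumes "x \<in> Vs"
  shows "DTb (DT x) = 0"
    "A 1 (DT x) + cj (W 0) * Ab 1 x + DTb (Ab 1 x) = x"
    "A (-2) (DT x) - 2 * cj (W 0) * Ab (-2) x + DTb (Ab (-2) x) + 2 * x = 0"
proof -
  have mix: "wd (Du i) (wd (Dub j) x) = 0" "wd (Dub j) (wd (Du i) x) = 0" for i j
    using assms by (auto simp: Vs_def wd_commute[of "Dub j"])
  have U: "wd DU x = 0" and E: "Eop x = 0" using assms by (auto simp: Vs_def)
  have [simp]: "Ab m (wd (Du i) x) = 0" for m i
    using A_eq_0[of "cj (wd (Du i) x)" m] mix by (simp add: cj_DA(3)[of m "cj _", simplified, symmetric] wd_cj)
  \<comment> \<open>Vanishing mixed derivatives remove the products of two exponentials, so only 1,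
    exp(u) and exp(-2u) remain in the equation.\<close>
  have AA: "A n (Ab m x) = 0" for n m
    by (rule A_eq_0) (simp add: wd_Ab)
  let ?x0 = "DTb (DT x)"
  let ?x1 = "x - A 1 (DT x) - cj (W 0) * Ab 1 x - DTb (Ab 1 x)"
  let ?x2 = "A (-2) (DT x) - 2 * cj (W 0) * Ab (-2) x + DTb (Ab (-2) x) + 2 * x"
  have ebD: "eb (DT x) = DTb (DT x) - Exu 1 * A 1 (DT x) + Exu (-2) * A (-2) (DT x)"
    by (simp add: eb_split wd_DT U)
  have ebA: "eb (Ab m x) = DTb (Ab m x)" for m
    by (simp add: eb_split wd_Ab U AA)
  have "e x = DT x - Exu 1 * Ab 1 x + Exu (-2) * Ab (-2) x"
    by (simp add: e_split U)
  then have "eb (e x) = eb (DT x) - (cj (W 0) * Exu 1 * Ab 1 x + Exu 1 * DTb (Ab 1 x))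
      + (Cn (-2) * cj (W 0) * Exu (-2) * Ab (-2) x + Exu (-2) * DTb (Ab (-2) x))"
    by (simp add: ebA)
  then have "Eop x = ?x0 + Exu 1 * ?x1 + Exu (-2) * ?x2"
    by (simp add: Eop_def ebD Cn_hom algebra_simps)
  then have sum0: "?x0 + Exu 1 * ?x1 + Exu (-2) * ?x2 = 0" using E by simp
  have "wd DU ?x0 = 0" "wd DU ?x1 = 0" "wd DU ?x2 = 0"
    by (simp_all add: wd_DTb wd_DT wd_Ab wd_A_simps U)
  from exp_split[OF sum0 this]
  show "DTb (DT x) = 0"
    "A 1 (DT x) + cj (W 0) * Ab 1 x + DTb (Ab 1 x) = x"
    "A (-2) (DT x) - 2 * cj (W 0) * Ab (-2) x + DTb (Ab (-2) x) + 2 * x = 0"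
    by (simp_all add: algebra_simps)
qed

section \<open>Restriction to the slice of vanishing jet variables\<close>

definition ev :: "complex \<Rightarrow> smf \<Rightarrow> complex" where "ev z x = fn x (z, 0, \<lambda>_. 0)"

lemma ev_simps [simp]: "ev z (x + y) = ev z x + ev z y" "ev z (x - y) = ev z x - ev z y"
  "ev z (- x) = - ev z x" "ev z (x * y) = ev z x * ev z y" "ev z 0 = 0" "ev z 1 = 1"
  "ev z (Cn c) = c" "ev z (numeral n) = numeral n" "ev z (of_nat m) = of_nat m"
  "ev z (W j) = 0" "ev z Z = z" "ev z (cj x) = cnj (ev z x)" "ev z (sum g B) = (\<Sum>i\<in>B. ev z (g i))"
  by (simp_all add: ev_def jz_def jw_def)

lemma ev_vf_single:
  assumes "\<And>j. j \<noteq> i \<Longrightarrow> ev z (a j) = 0 \<or> ev z (wd j x) = 0"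
  shows "ev z (vf a x) = ev z (a i) * ev z (wd i x)"
proof -
  have "vf a x = (\<Sum>j\<in>insert i (supp x). a j * wd j x)"
    by (rule vf_eq) (auto simp: finite_supp)
  then have "ev z (vf a x) = (\<Sum>j\<in>insert i (supp x). ev z (a j) * ev z (wd j x))" by simp
  also have "\<dots> = (\<Sum>j\<in>{i}. ev z (a j) * ev z (wd j x))"
  proof (rule sum.mono_neutral_right)
    show "\<forall>j\<in>insert i (supp x) - {i}. ev z (a j) * ev z (wd j x) = 0"
      using assms by auto
  qed (auto simp: finite_supp)
  finally show ?thesis by simp
qed

lemma ev_hpol: "hpol w x \<Longrightarrow> w > 0 \<Longrightarrow> ev z x = 0"
  by (induction rule: hpol.induct) auto

lemma ev_bell: "ev z (bell m j) = (if j = 0 then 1 else 0)"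
  using ev_hpol[OF hpol_bell] by auto

lemma ev_DT: "ev z (DT x) = ev z (wd Dz x)"
proof -
  have "ev z (dtc j) = 0" if "j \<noteq> Dz" for j using that by (cases j) auto
  then show ?thesis unfolding DT_def by (subst ev_vf_single[of Dz]) auto
qed

lemma ev_A: "ev z (A m x) = ev z (wd (Du 0) x)"
proof -
  have "ev z (alc m j) = 0" if "j \<noteq> Du 0" for j using that by (cases j) (auto simp: ev_bell)
  then show ?thesis unfolding A_def by (subst ev_vf_single[of "Du 0"]) auto
qed

lemma ev_DTb: "ev z (DTb x) = ev z (wd Dzb x)"
proof -
  have "DTb x = cj (DT (cj x))" by (simp add: cj_DA)
  then show ?thesis by (simp add: ev_DT wd_cj)
qed

lemma ev_Ab: "ev z (Ab m x) = ev z (wd (Dub 0) x)"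
proof -
  have "Ab m x = cj (A m (cj x))" by (simp add: cj_DA)
  then show ?thesis by (simp add: ev_A wd_cj)
qed

text \<open>The linear part of \<open>bell m j\<close> is \<open>m u_(j-1)\<close>; by weight, any
  other first derivative is zero or has positive weight and vanishes on the slice.\<close>

lemma ev_wd_bell: "ev z (wd (Du k) (bell m j)) = (if j = Suc k then m else 0)"
proof -
  consider "j < Suc k" | "j = Suc k" | "j > Suc k" by linarith
  then show ?thesis
  proof cases
    case 1
    then show ?thesis using wd_hpol_high[OF hpol_bell[of j m]] by simp
  next
    case 2
    have "wtd k (\<lambda>j. if j = Du k then 1 else 0)"
      by (auto simp: wtd_def intro: hpol.zero hpol_simps)
    from vf_bell[OF this, of 1] show ?thesis
      unfolding wd_as_vf[symmetric] by (simp add: 2)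
  next
    case 3
    then show ?thesis using ev_hpol[OF hpol_wd[OF hpol_bell[of j m], of k]] by simp
  qed
qed

lemma bell_Suc: "bell m (Suc j) = DT (bell m j) + Cn m * W 0 * bell m j"
proof -
  have "Ab n (bell m j) = 0" for n
    using A_eq_0[of "cj (bell m j)" n] by (simp add: wd_cj cj_DA(3)[of n "cj _", simplified, symmetric])
  then have "e (bell m j) = DT (bell m j)" by (simp add: e_split)
  then show ?thesis using e_bell[of m j] by (metis diff_add_cancel)
qed

text \<open>Reads off the quadratic part. In the induction through \<open>bell_Suc\<close>,
  \<open>DT\<close> lowers one of the two indices, the factor \<open>W 0\<close> supplies the
  boundary cases, and the binomials add by Pascal's rule.\<close>

lemma ev_wd_wd_bell: "ev z (wd (Du l) (wd (Du k) (bell m j))) =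
    (if j = k + l + 2 then m\<^sup>2 * of_nat ((k + l + 2) choose Suc k) else 0)"
proof (induction j arbitrary: k l)
  case (Suc j)
  let ?b = "bell m j"
  have [simp]: "DT (wd Dz x) = wd Dz (DT x)" for x by (simp add: wd_DT)
  have D0: "ev z (DT (wd (Du l) (wd (Du k) ?b))) = 0" "ev z (DT (wd (Du k) ?b)) = 0" for k l
    by (simp_all add: ev_DT wd_commute[of Dz])
  have 1: "ev z (wd (Du l) (wd (Du k) (DT ?b))) =
      (case k of 0 \<Rightarrow> 0 | Suc k' \<Rightarrow> ev z (wd (Du l) (wd (Du k') ?b))) +
      (case l of 0 \<Rightarrow> 0 | Suc l' \<Rightarrow> ev z (wd (Du l') (wd (Du k) ?b)))"
    by (cases k; cases l) (simp_all add: wd_DT D0)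
  have 2: "ev z (wd (Du l) (wd (Du k) (Cn m * W 0 * ?b))) =
      m * ((if k = 0 then ev z (wd (Du l) ?b) else 0) + (if l = 0 then ev z (wd (Du k) ?b) else 0))"
    by (simp add: algebra_simps)
  have "ev z (wd (Du l) (wd (Du k) (bell m (Suc j)))) =
      ev z (wd (Du l) (wd (Du k) (DT ?b))) + ev z (wd (Du l) (wd (Du k) (Cn m * W 0 * ?b)))"
    by (simp only: bell_Suc wd_simps ev_simps)
  then show ?case
    unfolding 1 2 Suc ev_wd_bell
    by (cases k; cases l) (auto simp: power2_eq_square algebra_simps numeral_2_eq_2)
qed simp

section \<open>Functions constant along coordinate directions\<close>

lemma constant_along:
  assumes "\<And>t. pd c (fn x) (shift c t p) = 0"
  shows "fn x (shift c t p) = fn x p"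
proof -
  have "((\<lambda>t. fn x (shift c t p)) has_vector_derivative 0) (at t within UNIV)" for t
    using smooth_derivative[of "fn x" c p t] assms by simp
  then obtain a where "\<And>t. fn x (shift c t p) = a"
    using has_vector_derivative_zero_constant[of UNIV "\<lambda>t. fn x (shift c t p)"] by auto
  then show ?thesis by (metis shift_zero)
qed

lemma pdr_z: "pdr Re_z x = wd Dz x + wd Dzb x" "pdr Im_z x = Cn \<i> * (wd Dz x - wd Dzb x)"
  by (auto intro!: smf_eqI simp: wd.simps field_simps)

lemma pdr_w: "pdr (Re_u j) x = wd (Du j) x + wd (Dub j) x"
  "pdr (Im_u j) x = Cn \<i> * (wd (Du j) x - wd (Dub j) x)"
  by (auto intro!: smf_eqI simp: wd.simps field_simps)

lemma ev_slice_constant: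
  assumes "\<And>z. ev z (wd Dz x) = 0" "\<And>z. ev z (wd Dzb x) = 0"
  shows "ev z x = ev 0 x"
proof -
  have pd: "pd c (fn x) (z, 0, \<lambda>_. 0) = 0" if "c \<in> {Re_z, Im_z}" for c z
    using assms that unfolding fn_pdr[symmetric] ev_def[symmetric] by (auto simp: pdr_z)
  have re: "ev (of_real t) x = ev 0 x" for t
    using constant_along[of Re_z x "(0, 0, \<lambda>_. 0)" t] pd by (simp add: ev_def)
  have "ev (of_real (Re z) + \<i> * of_real t) x = ev (of_real (Re z)) x" for t
    using constant_along[of Im_z x "(of_real (Re z), 0, \<lambda>_. 0)" t] pd by (simp add: ev_def)
  from this[of "Im z"] re show ?thesis by (simp add: complex_eq[symmetric])
qed

lemma ev_slice_zero:
  assumes "\<And>z. ev z x = 0"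
  shows "ev z (wd Dz x) = 0" "ev z (wd Dzb x) = 0"
proof -
  have "pd c (fn x) (z, 0, \<lambda>_. 0) = 0" if "c \<in> {Re_z, Im_z}" for c
    using that assms by (intro pd_eqI) (auto simp: ev_def intro!: derivative_eq_intros)
  then have "ev z (pdr Re_z x) = 0" "ev z (pdr Im_z x) = 0"
    unfolding ev_def fn_pdr by auto
  then show "ev z (wd Dz x) = 0" "ev z (wd Dzb x) = 0"
    by (simp_all add: wd.simps)
qed

lemma fn_eq_ev:
  assumes "wd DU x = 0" "\<And>j. wd (Du j) x = 0" "\<And>j. wd (Dub j) x = 0"
  shows "fn x (z, u, w) = ev z x"
proof -
  have pd: "pd c (fn x) p = 0" if "c \<notin> {Re_z, Im_z}" for c p
    using that assms unfolding fn_pdr[symmetric] by (cases c) (auto simp: pdr_w wd.simps(3)[symmetric])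
  note const = constant_along[OF pd]
  have u: "fn x (z, u, w) = fn x (z, 0, w)" for w
    using const[where c = U and p = "(z, 0, w)" and t = u] by simp
  \<comment> \<open>The jet variables are moved to zero one at a time; finitely many moves suffice
    because the function depends on finitely many of them.\<close>
  have w: "fn x (z, 0, \<lambda>j. if j < m then 0 else w j) = fn x (z, 0, w)" for m
  proof (induction m)
    case (Suc m)
    let ?w = "\<lambda>j. if j < m then 0 else w j"
    have "fn x (z, 0, ?w) = fn x (shift (Im_u m) (- Im (w m)) (shift (Re_u m) (- Re (w m)) (z, 0, ?w)))"
      by (simp only: const insert_iff coord.distinct empty_iff simp_thms)
    also have "shift (Im_u m) (- Im (w m)) (shift (Re_u m) (- Re (w m)) (z, 0, ?w)) =
        (z, 0, \<lambda>j. if j < Suc m then 0 else w j)"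
      by (auto simp: fun_eq_iff less_Suc_eq complex_eq_iff)
    finally show ?case using Suc by simp
  qed simp
  obtain n where "depends_below n (fn x)" using smooth_depends smooth_fun_fn by blast
  then have "fn x (z, 0, \<lambda>j. if j < n then 0 else w j) = fn x (z, 0, \<lambda>_. 0)"
    unfolding depends_below_def by (auto simp: jz_def ju_def jw_def)
  then show ?thesis using u w[of n] by (simp add: ev_def)
qed

section \<open>Consequences of the three equations for an element of \<open>Vs\<close>\<close>

context
  fixes x assumes x: "x \<in> Vs"
begin

lemma Vs_mixed: "wd (Du i) (wd (Dub j) x) = 0" "wd (Dub j) (wd (Du i) x) = 0"
  using x by (auto simp: Vs_def wd_commute[of "Dub j"])

lemma Vs_DU: "wd DU x = 0"
  using x by (auto simp: Vs_def)

lemma Vs_wd_Ab: "Ab m (wd (Du i) x) = 0"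
  using A_eq_0[of "cj (wd (Du i) x)" m] Vs_mixed
  by (simp add: cj_DA(3)[of m "cj _", simplified, symmetric] wd_cj)

text \<open>Differentiate \<open>DTb (DT x) = 0\<close> by u_(k+1). No antiholomorphic jet variable
  is left, so \<open>DTb\<close> acts as the derivative by the conjugate of z; the commutator with
  \<open>DT\<close> then expresses the claim for \<open>k\<close> by the one for
  \<open>k + 1\<close>.\<close>

lemma Vs_hol: "wd Dzb (wd (Du k) x) = 0"
proof -
  have step: "DT (wd Dzb (wd (Du (Suc k)) x)) + wd Dzb (wd (Du k) x) = 0" for k
  proof -
    let ?y = "wd (Du (Suc k)) (DT x)"
    have "wd (Dub j) ?y = 0" for j
      by (simp add: wd_DT Vs_mixed)
    then have "wd Dzb ?y = DTb ?y" by (simp add: DTb_eq_wd)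
    also have "\<dots> = wd (Du (Suc k)) (DTb (DT x))" by (simp add: wd_DTb)
    also have "\<dots> = 0" using Vs_equations(1)[OF x] by simp
    finally show ?thesis by (simp add: wd_DT)
  qed
  obtain n where n: "\<And>j. j \<ge> n \<Longrightarrow> wd (Du j) x = 0" using wd_eventually_0 by metis
  show ?thesis
  proof (rule downward_induct[of n "\<lambda>k. wd Dzb (wd (Du k) x) = 0"])
    show "wd Dzb (wd (Du k) x) = 0" if "\<And>i. i > k \<Longrightarrow> wd Dzb (wd (Du i) x) = 0" for k
      using step[of k] that by simp
  qed (simp add: n)
qed

text \<open>A derivative by u_k annihilates the antiholomorphic terms in the coefficients of exp(u)
  and exp(-2u).\<close>

lemma Vs_wd_A_DT: "m \<in> {1, -2} \<Longrightarrow> wd (Du k) (A m (DT x)) = Cn m * wd (Du k) x"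
proof -
  have "wd (Du k) (A 1 (DT x)) = wd (Du k) x"
    using Vs_equations(2)[OF x, THEN arg_cong[of _ _ "wd (Du k)"]]
    by (simp add: wd_Ab wd_DTb Vs_wd_Ab)
  moreover have "wd (Du k) (A (-2) (DT x)) = - 2 * wd (Du k) x"
    using Vs_equations(3)[OF x, THEN arg_cong[of _ _ "wd (Du k)"]]
    by (simp add: wd_Ab wd_DTb Vs_wd_Ab eq_neg_iff_add_eq_0)
  ultimately show "m \<in> {1, -2} \<Longrightarrow> wd (Du k) (A m (DT x)) = Cn m * wd (Du k) x"
    by (auto simp: Cn_hom)
qed

text \<open>Take \<open>Vs_wd_A_DT\<close> at the index \<open>Suc n\<close>, where the right side
  vanishes. Coefficients \<open>bell m j\<close> involving u_(n+1) have \<open>j > Suc n\<close> and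
  meet no derivative of \<open>DT x\<close>, so only the commutator term, the derivative by u_n,
  remains.\<close>

lemma Vs_top:
  assumes "\<And>i. i > n \<Longrightarrow> wd (Du i) x = 0" and m: "m \<in> {1, -2}"
  shows "A m (wd (Du n) x) = 0"
proof -
  have y: "wd (Du j) (DT x) = 0" if "j > Suc n" for j
    using that assms(1) by (cases j) (auto simp: wd_DT)
  have "wd (Du (Suc n)) (bell m j) = 0 \<or> wd (Du j) (DT x) = 0" for j
    using wd_hpol_high[OF hpol_bell[of j m], of "Suc n"] y[of j] by linarith
  then have "wd (Du (Suc n)) (alc m i) = 0 \<or> wd i (DT x) = 0" for i
    by (cases i) auto
  then have "wd (Du (Suc n)) (A m (DT x)) = A m (wd (Du (Suc n)) (DT x))"
    unfolding A_def wd_vf by (simp add: vf_eq_0)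
  also have "\<dots> = A m (wd (Du n) x)"
    using assms(1) by (simp add: wd_DT)
  finally show ?thesis using Vs_wd_A_DT[OF m] assms(1) by simp
qed

text \<open>By \<open>kernel\<close>, the highest nonzero derivative depends on z only, so its
  values on the slice determine it; descend through the indices.\<close>

lemma Vs_linear_part_zero:
  assumes "\<And>k z. ev z (wd (Du k) x) = 0"
  shows "wd (Du k) x = 0"
proof -
  obtain n where "\<And>j. j \<ge> n \<Longrightarrow> wd (Du j) x = 0" using wd_eventually_0 by metis
  then show ?thesis
  proof (rule downward_induct)
    fix k assume above: "\<And>i. i > k \<Longrightarrow> wd (Du i) x = 0"
    have "wd (Du j) (wd (Du k) x) = 0" for j
      using kernel Vs_top[OF above] unfolding A_def by simp
    then have "fn (wd (Du k) x) (z, u, w) = 0" for z u w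
      using fn_eq_ev[of "wd (Du k) x"] assms
      by (simp add: Vs_mixed wd_commute[of DU] Vs_DU)
    then show "wd (Du k) x = 0"
      by (intro smf_eqI) (simp add: split_paired_all)
  qed
qed

lemma ev_wd_A: "ev z (wd (Du k) (A m y)) =
    m * ev z (wd (Du (Suc k)) y) + ev z (wd (Du 0) (wd (Du k) y))"
proof -
  have "ev z (wd (Du k) (alc m i)) = 0" if "i \<noteq> Du (Suc k)" for i
    using that by (cases i) (auto simp: ev_wd_bell)
  then have "ev z (vf (\<lambda>i. wd (Du k) (alc m i)) y) = m * ev z (wd (Du (Suc k)) y)"
    by (subst ev_vf_single[of "Du (Suc k)"]) (auto simp: ev_wd_bell)
  then show ?thesis
    unfolding A_def wd_vf by (simp add: ev_A[unfolded A_def])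
qed

text \<open>On the slice, \<open>Vs_wd_A_DT\<close> is a relation affine in \<open>m\<close>. Its
  validity for both 1 and -2 forces the constant term and the coefficient of \<open>m\<close> to
  vanish separately.\<close>

lemma Vs_first_order:
  "ev z (wd Dz (wd (Du (Suc k)) x)) = 0" "ev z (wd (Du 0) (wd (Du k) (DT x))) = 0"
proof -
  have *: "m * ev z (wd (Du (Suc k)) (DT x)) + ev z (wd (Du 0) (wd (Du k) (DT x))) =
      m * ev z (wd (Du k) x)" if "m \<in> {1, -2}" for m
    using ev_wd_A[of z k m "DT x"] Vs_wd_A_DT[OF that, of k] by simp
  have lin: "a = p \<and> b = 0" if "1 * a + b = 1 * p" "- 2 * a + b = - 2 * p" for a b p :: complex
  proof -
    have "3 * a = 3 * p" using that by algebra
    then show ?thesis using that by simp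
  qed
  have "ev z (wd (Du (Suc k)) (DT x)) = ev z (wd (Du k) x)"
    "ev z (wd (Du 0) (wd (Du k) (DT x))) = 0"
    using lin[OF *[of 1] *[of "-2"]] by simp_all
  then show "ev z (wd Dz (wd (Du (Suc k)) x)) = 0" "ev z (wd (Du 0) (wd (Du k) (DT x))) = 0"
    by (simp_all add: wd_DT ev_DT)
qed

lemma Vs_zero_order: "ev z x = 0"
  "ev z (wd Dz (wd (Du 0) x)) + ev z (wd Dzb (wd (Dub 0) x)) = 0"
proof -
  have 1: "ev z (A m (DT x)) = ev z (wd Dz (wd (Du 0) x))" for m
    by (simp add: ev_A wd_DT ev_DT)
  have 2: "ev z (DTb (Ab m x)) = ev z (wd Dzb (wd (Dub 0) x))" for m
    by (simp add: ev_DTb wd_Ab ev_Ab wd_commute[of "Dub 0"])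
  have "ev z (wd Dz (wd (Du 0) x)) + ev z (wd Dzb (wd (Dub 0) x)) = ev z x"
    "ev z (wd Dz (wd (Du 0) x)) + ev z (wd Dzb (wd (Dub 0) x)) + 2 * ev z x = 0"
    using Vs_equations(2,3)[OF x, THEN arg_cong[of _ _ "ev z"]] by (simp_all add: 1 2)
  then show "ev z x = 0" "ev z (wd Dz (wd (Du 0) x)) + ev z (wd Dzb (wd (Dub 0) x)) = 0"
    by auto
qed

end

section \<open>Weights, injectivity and the obstruction in degree \<open>6k + 3\<close>\<close>

lemma Vs_dz_bar: "x \<in> Vs \<Longrightarrow> wd Dz (wd (Dub k) x) = 0"
  using Vs_hol[OF cj_in_Vs, of x k] by (simp add: wd_cj)

text \<open>Applying \<open>Vs_linear_part_zero\<close> to \<open>x\<close> and to its conjugate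
  leaves a function of z alone, which vanishes by \<open>Vs_zero_order\<close>.\<close>

lemma Vs_uniqueness:
  assumes x: "x \<in> Vs" and "\<And>k z. ev z (wd (Du k) x) = 0" "\<And>k z. ev z (wd (Dub k) x) = 0"
  shows "x = 0"
proof -
  have "wd (Du k) x = 0" for k using Vs_linear_part_zero[OF x assms(2)] .
  moreover have "wd (Dub k) x = 0" for k
    using Vs_linear_part_zero[OF cj_in_Vs[OF x], of k] assms(3) by (simp add: wd_cj)
  ultimately have "fn x (z, u, w) = ev z x" for z u w
    by (intro fn_eq_ev) (use x in \<open>auto simp: Vs_def\<close>)
  then show ?thesis
    using Vs_zero_order(1)[OF x] by (intro smf_eqI) (simp add: split_paired_all)
qed

text \<open>The coefficient of z u_0, the only part of a first jet derivative on the slice that is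
  not constant.\<close>

definition z_slope :: "smf \<Rightarrow> complex" where "z_slope x = ev 0 (wd Dz (wd (Du 0) x))"

text \<open>On the slice, \<open>?q\<close> plus its antiholomorphic counterpart vanishes. The
  z-derivative kills the counterpart and the conjugate derivative kills \<open>?q\<close>, so
  \<open>?q\<close> is constant there.\<close>

lemma Vs_kap:
  assumes x: "x \<in> Vs"
  shows "ev z (wd Dz (wd (Du 0) x)) = z_slope x" "z_slope (cj x) = - cnj (z_slope x)"
proof -
  let ?q = "wd Dz (wd (Du 0) x)"
  have "ev z (wd Dz (?q + wd Dzb (wd (Dub 0) x))) = 0" for z
    by (rule ev_slice_zero) (use Vs_zero_order(2)[OF x] in simp)
  moreover have "wd Dz (wd Dzb (wd (Dub 0) x)) = 0"
    by (subst wd_commute) (simp add: Vs_dz_bar[OF x])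
  moreover have "wd Dzb ?q = 0"
    by (subst wd_commute) (simp add: Vs_hol[OF x])
  ultimately show "ev z ?q = z_slope x"
    unfolding z_slope_def by (intro ev_slice_constant) auto
  show "z_slope (cj x) = - cnj (z_slope x)"
    using Vs_zero_order(2)[OF x, of 0] unfolding z_slope_def
    by (simp add: wd_cj eq_neg_iff_add_eq_0 add.commute flip: complex_cnj_add)
qed

lemma Vs_slice:
  assumes x: "x \<in> Vs"
  shows "ev z (wd (Du 0) x) = z_slope x * z + ev 0 (wd (Du 0) x)"
    "ev z (wd (Du (Suc k)) x) = ev 0 (wd (Du (Suc k)) x)"
proof -
  have "ev z (wd (Du 0) x - Cn (z_slope x) * Z) = ev 0 (wd (Du 0) x - Cn (z_slope x) * Z)"
    by (rule ev_slice_constant) (simp_all add: Vs_kap[OF x] Vs_hol[OF x])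
  then show "ev z (wd (Du 0) x) = z_slope x * z + ev 0 (wd (Du 0) x)"
    by (simp add: algebra_simps)
  show "ev z (wd (Du (Suc k)) x) = ev 0 (wd (Du (Suc k)) x)"
    by (rule ev_slice_constant) (simp_all add: Vs_first_order[OF x] Vs_hol[OF x])
qed

lemma wd_Dz_e: "wd Dz (e x) = e (wd Dz x)"
proof -
  have "wd Dz (Tm i) = 0" "wd Dzb (Tm i) = 0" for i by (simp_all add: Tm_def)
  then have "wd Dz (ec i) = 0" for i by (cases i) (simp_all add: wd_cj)
  then show ?thesis by (simp add: e_def wd_vf vf_coeff)
qed

lemma wd_Dz_eb: "wd Dz (eb x) = eb (wd Dz x)"
proof -
  have "wd Dz (Tm i) = 0" "wd Dzb (Tm i) = 0" for i by (simp_all add: Tm_def)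
  then have "wd Dz (cj (ec (bar i))) = 0" for i by (cases i) (simp_all add: wd_cj)
  then show ?thesis by (simp add: eb_def wd_vf vf_coeff)
qed

text \<open>Translation in z is a symmetry, since z does not occur in the coefficients of
  \<open>e\<close> and \<open>eb\<close>.\<close>

lemma Dz_in_Vs: "x \<in> Vs \<Longrightarrow> wd Dz x \<in> Vs"
proof -
  assume x: "x \<in> Vs"
  have "Eop (wd Dz x) = wd Dz (Eop x)" by (simp add: Eop_def wd_Dz_e wd_Dz_eb)
  then show ?thesis
    using x by (simp add: Vs_def wd_commute[of _ Dz])
qed

text \<open>Continuous partial derivatives give total differentiability in the plane of two
  coordinates. This is needed because F_\<lambda> rotates the real and imaginary parts of u_k into
  each other.\<close>

lemma smooth_plane_derivative:
  assumes P: "smooth_fun P"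
  shows "((\<lambda>t. P (shift c (t * a) (shift d (t * b) p))) has_vector_derivative
    a * pd c P p + b * pd d P p) (at 0)"
proof -
  let ?g = "\<lambda>s t. P (shift c s (shift d t p))"
  have ds: "((\<lambda>s. ?g s 0) has_derivative (\<lambda>h. h *\<^sub>R pd c P p)) (at 0 within UNIV)"
    using smooth_derivative_0[OF P] by (simp add: has_vector_derivative_def)
  have dt: "(?g s has_derivative blinfun_scaleR_left (pd d P (shift c s (shift d t p)))) (at t within UNIV)"
    for s t
    using smooth_derivative[OF P, of d "shift c s p" t]
    by (simp add: has_vector_derivative_def shift_commute[of c])
  have "continuous_on UNIV (\<lambda>x. pd d P (shift c (fst x) (shift d (snd x) p)))"
    by (rule continuous_on_compose2[OF smooth_continuous continuous_shift_shift]) (use P in auto)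
  then have "continuous_on UNIV (\<lambda>(s, t). blinfun_scaleR_left (pd d P (shift c s (shift d t p))))"
    unfolding case_prod_unfold
    by (rule bounded_linear.continuous_on[OF bounded_linear_blinfun_scaleR_left])
  then have cont: "continuous (at (0, 0) within UNIV \<times> UNIV)
      (\<lambda>(s, t). blinfun_scaleR_left (pd d P (shift c s (shift d t p))))"
    by (simp add: continuous_on_eq_continuous_at)
  have "((\<lambda>(s, t). ?g s t) has_derivative
      (\<lambda>(s, t). s *\<^sub>R pd c P p + t *\<^sub>R pd d P p)) (at (0, 0) within UNIV \<times> UNIV)"
    using has_derivative_partialsI[OF ds dt cont] by simp
  then have "((\<lambda>(s, t). ?g s t) has_derivative (\<lambda>(s, t). s *\<^sub>R pd c P p + t *\<^sub>R pd d P p))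
      (at ((\<lambda>t. (t * a, t * b)) 0))" by simp
  moreover have "((\<lambda>t. (t * a, t * b)) has_derivative (\<lambda>t. (t * a, t * b))) (at 0)"
    by (auto intro!: derivative_eq_intros)
  ultimately have "((\<lambda>(s, t). ?g s t) \<circ> (\<lambda>t. (t * a, t * b)) has_derivative
      (\<lambda>(s, t). s *\<^sub>R pd c P p + t *\<^sub>R pd d P p) \<circ> (\<lambda>t. (t * a, t * b))) (at 0)"
    using diff_chain_at by blast
  then show ?thesis
    by (simp add: has_vector_derivative_def o_def scaleR_conv_of_real algebra_simps)
qed

text \<open>Differentiate the weight condition at \<open>p\<close> in a complex direction
  \<open>v\<close> of the u_k-plane; \<open>F l\<close> carries this to the direction
  \<open>l ^ (k + 1) * v\<close>.\<close>

lemma weighted_degree_wd: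
  assumes w: "weighted_degree d (fn x)" and l: "cmod l = 1"
  shows "l ^ (k + 1) * fn (wd (Du k) x) (F l p) = l powi d * fn (wd (Du k) x) p"
proof -
  let ?P = "fn x"
  define mv where "mv v t q = shift (Re_u k) (t * Re v) (shift (Im_u k) (t * Im v) q)" for v t q
  have der: "((\<lambda>t. ?P (mv v t q)) has_vector_derivative
      v * fn (wd (Du k) x) q + cnj v * fn (wd (Dub k) x) q) (at 0)" for v q
  proof -
    have "Re v * pd (Re_u k) ?P q + Im v * pd (Im_u k) ?P q =
        v * fn (wd (Du k) x) q + cnj v * fn (wd (Dub k) x) q"
    proof -
      have "of_real a * (X + Y) + of_real b * (\<i> * (X - Y)) =
          Complex a b * X + cnj (Complex a b) * Y" for a b X Y
        by (simp add: complex_eq_iff algebra_simps)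
      from this[of "Re v" _ _ "Im v"] show ?thesis
        unfolding fn_pdr[symmetric] pdr_w by simp
    qed
    then show ?thesis
      unfolding mv_def using smooth_plane_derivative[of ?P "Re_u k" "Re v" "Im_u k" "Im v" q]
      by (simp only: smooth_fun_fn simp_thms)
  qed
  have mv_eq: "mv v t q = (fst q, fst (snd q), (snd (snd q))(k := snd (snd q) k + of_real t * v))"
    for v t q
  proof -
    have "of_real t * v = \<i> * of_real (t * Im v) + of_real (t * Re v)"
      by (simp add: complex_eq_iff)
    then show ?thesis by (simp add: mv_def add.assoc)
  qed
  have mv: "F l (mv v t p) = mv (l ^ (k + 1) * v) t (F l p)" for v t
    unfolding mv_eq F_def jz_def ju_def jw_def by (auto simp: fun_eq_iff algebra_simps)
  have eq: "(l ^ (k + 1) * v) * fn (wd (Du k) x) (F l p) +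
      cnj (l ^ (k + 1) * v) * fn (wd (Dub k) x) (F l p) =
      l powi d * (v * fn (wd (Du k) x) p + cnj v * fn (wd (Dub k) x) p)" for v
  proof (rule vector_derivative_unique_at)
    show "((\<lambda>t. ?P (mv (l ^ (k + 1) * v) t (F l p))) has_vector_derivative
        (l ^ (k + 1) * v) * fn (wd (Du k) x) (F l p) +
        cnj (l ^ (k + 1) * v) * fn (wd (Dub k) x) (F l p)) (at 0)"
      by (rule der)
    have "?P (mv (l ^ (k + 1) * v) t (F l p)) = l powi d * ?P (mv v t p)" for t
      using w l unfolding mv[symmetric] weighted_degree_def by blast
    then show "((\<lambda>t. ?P (mv (l ^ (k + 1) * v) t (F l p))) has_vector_derivative
        l powi d * (v * fn (wd (Du k) x) p + cnj v * fn (wd (Dub k) x) p)) (at 0)"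
      by (simp add: has_vector_derivative_mult_right[OF der])
  qed
  \<comment> \<open>Evaluating \<open>eq\<close> at 1 and at the imaginary unit isolates the part
    that is complex linear in \<open>v\<close>.\<close>
  have "2 * (l ^ (k + 1) * fn (wd (Du k) x) (F l p)) = 2 * (l powi d * fn (wd (Du k) x) p)"
    if "L * X + M * Y = D * (A + B)" "(L * \<i>) * X + (M * - \<i>) * Y = D * (\<i> * A + - \<i> * B)"
      "L = l ^ (k + 1)" "X = fn (wd (Du k) x) (F l p)" "D = l powi d" "A = fn (wd (Du k) x) p"
    for L X M Y D A B
  proof -
    have "\<i> * (L * X - M * Y) = \<i> * (D * (A - B))" using that(2) by (simp add: algebra_simps)
    then have "L * X - M * Y = D * (A - B)" by (subst (asm) mult_cancel_left) simp
    then show ?thesis using that(1) unfolding that(3-)[symmetric] by algebra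
  qed
  from this[of _ _ "cnj (l ^ (k + 1))"] eq[of 1] eq[of "\<i>"] show ?thesis by simp
qed

lemma weighted_degree_cj:
  "weighted_degree d (fn x) \<Longrightarrow> weighted_degree (- d) (fn (cj x))"
proof -
  have "cnj (l powi d) = l powi (- d)" if "cmod l = 1" for l
  proof -
    have "cnj l * l = 1" using that by (simp add: complex_norm_square[symmetric] mult.commute)
    then have "cnj l = inverse l" using inverse_unique by (metis mult.commute)
    then show ?thesis by (simp add: power_int_minus power_int_inverse)
  qed
  then show "weighted_degree d (fn x) \<Longrightarrow> weighted_degree (- d) (fn (cj x))"
    by (simp add: weighted_degree_def)
qed

lemma unit_powi:
  assumes "\<And>l. cmod l = 1 \<Longrightarrow> l powi m = l powi n"
  shows "m = n"
proof (rule ccontr)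
  assume mn: "m \<noteq> n"
  define k where "k = nat \<bar>m - n\<bar>"
  have k: "k > 0" using mn by (simp add: k_def)
  have "l ^ k = 1" if "cmod l = 1" for l
  proof -
    have l: "l \<noteq> 0" using that by auto
    have "l powi (m - n) = 1" "l powi (n - m) = 1"
      using assms[OF that] l by (simp_all add: power_int_diff)
    then have "l powi (int k) = 1" unfolding k_def by (simp add: abs_if split: if_splits)
    then show ?thesis by (simp add: power_int_of_nat)
  qed
  \<comment> \<open>This unit number has \<open>k\<close>-th power \<open>cis 1\<close>, which
    differs from 1.\<close>
  then have "cis (1 / k) ^ k = 1" by simp
  moreover have "cis (1 / k) ^ k = cis (real k * (1 / real k))" by (rule Complex.DeMoivre)
  moreover have "real k * (1 / real k) = 1" using k by simp
  ultimately have "cis 1 = 1" by metis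
  then have "cos 1 = (1 :: real)" by (metis cis.sel(1) one_complex.sel(1))
  then show False using cos_monotone_0_pi[of 0 1] pi_gt3 by simp
qed

text \<open>The monomials u_k and z u_0 have weights \<open>k + 1\<close> and 0, so other degrees
  exclude them.\<close>

lemma weight_linear_part:
  assumes x: "x \<in> Vs" and w: "weighted_degree d (fn x)"
  shows "d \<noteq> int k + 1 \<Longrightarrow> ev 0 (wd (Du k) x) = 0" "d \<noteq> 0 \<Longrightarrow> z_slope x = 0"
proof -
  have F: "F l (z, 0, \<lambda>_. 0) = (inverse l * z, 0, \<lambda>_. 0)" for l z
    by (simp add: F_def jz_def ju_def jw_def)
  have W: "l ^ (k + 1) * ev (inverse l * z) (wd (Du k) x) = l powi d * ev z (wd (Du k) x)"
    if "cmod l = 1" for l k z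
    using weighted_degree_wd[OF w that, of k "(z, 0, \<lambda>_. 0)"] by (simp only: F ev_def)
  show "ev 0 (wd (Du k) x) = 0" if d: "d \<noteq> int k + 1" for k
  proof (rule ccontr)
    assume nz: "ev 0 (wd (Du k) x) \<noteq> 0"
    have "l powi (int k + 1) = l powi d" if "cmod l = 1" for l
    proof -
      have "l ^ (k + 1) = l powi d" using W[OF that, of k 0] nz by simp
      moreover have "l powi (int k + 1) = l ^ (k + 1)"
        by (metis of_nat_1 of_nat_add power_int_of_nat)
      ultimately show ?thesis by simp
    qed
    then show False using unit_powi d by blast
  qed
  show "z_slope x = 0" if d: "d \<noteq> 0"
  proof (rule ccontr)
    assume nz: "z_slope x \<noteq> 0"
    have "l powi 0 = l powi d" if l: "cmod l = 1" for l
    proof -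
      let ?c = "ev 0 (wd (Du 0) x)"
      have l0: "l \<noteq> 0" using l by auto
      have "l * (z_slope x * (inverse l * 1) + ?c) = l powi d * (z_slope x * 1 + ?c)"
        using W[OF l, of 0 1] Vs_slice(1)[OF x, of 1] Vs_slice(1)[OF x, of "inverse l * 1"] by simp
      moreover have "l * ?c = l powi d * ?c" using W[OF l, of 0 0] by simp
      ultimately have "z_slope x = l powi d * z_slope x"
        using l0 by (simp add: distrib_left)
      then show ?thesis using nz by simp
    qed
    then show False using unit_powi d by blast
  qed
qed

text \<open>For \<open>d \<ge> 0\<close> the antiholomorphic linear terms have negative weight and
  vanish, so weights leave one candidate number: the coefficient of z u_0 if \<open>d = 0\<close>,
  that of u_(d-1) if \<open>d > 0\<close>.\<close>

lemma V_degree_injective: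
  assumes x: "x \<in> Vs" and w: "weighted_degree d (fn x)" and d: "d \<ge> 0"
    and "d = 0 \<Longrightarrow> z_slope x = 0" "d > 0 \<Longrightarrow> ev 0 (wd (Du (nat (d - 1))) x) = 0"
  shows "x = 0"
proof (rule Vs_uniqueness[OF x])
  have z_slope: "z_slope x = 0" using weight_linear_part(2)[OF x w] assms(4) by blast
  have "ev 0 (wd (Du k) x) = 0" for k
    using weight_linear_part(1)[OF x w, of k] assms(5) by (cases "d = int k + 1") auto
  then show "ev z (wd (Du k) x) = 0" for z k
    using Vs_slice[OF x, of z] z_slope by (cases k) auto
  note cx = cj_in_Vs[OF x]
  have "ev 0 (wd (Du k) (cj x)) = 0" for k
    by (rule weight_linear_part(1)[OF cx weighted_degree_cj[OF w]]) (use d in simp)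
  moreover have "z_slope (cj x) = 0" using Vs_kap(2)[OF x] z_slope by simp
  ultimately have "ev z (wd (Du k) (cj x)) = 0" for z k
    using Vs_slice[OF cx, of z] by (cases k) auto
  then show "ev z (wd (Dub k) x) = 0" for z k
    by (simp add: wd_cj)
qed

section \<open>Second derivatives at the origin and the obstruction in degree 6k+3\<close>

lemma ev_wd_wd_A: "ev z (wd (Du l) (wd (Du k) (A m y))) =
    m\<^sup>2 * of_nat ((k + l + 2) choose Suc k) * ev z (wd (Du (k + l + 2)) y) +
    m * (ev z (wd (Du (Suc k)) (wd (Du l) y)) + ev z (wd (Du (Suc l)) (wd (Du k) y))) +
    ev z (wd (Du 0) (wd (Du l) (wd (Du k) y)))"
proof -
  have 1: "ev z (vf (\<lambda>i. wd (Du k) (alc m i)) y) = m * ev z (wd (Du (Suc k)) y)" for k y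
  proof -
    have "ev z (wd (Du k) (alc m i)) = 0" if "i \<noteq> Du (Suc k)" for i
      using that by (cases i) (auto simp: ev_wd_bell)
    then show ?thesis
      by (subst ev_vf_single[of "Du (Suc k)"]) (auto simp: ev_wd_bell)
  qed
  have 2: "ev z (vf (\<lambda>i. wd (Du l) (wd (Du k) (alc m i))) y) =
      m\<^sup>2 * of_nat ((k + l + 2) choose Suc k) * ev z (wd (Du (k + l + 2)) y)"
  proof -
    have "ev z (wd (Du l) (wd (Du k) (alc m i))) = 0" if "i \<noteq> Du (k + l + 2)" for i
      using that by (cases i) (auto simp: ev_wd_wd_bell)
    then show ?thesis
      by (subst ev_vf_single[of "Du (k + l + 2)"]) (auto simp: ev_wd_wd_bell)
  qed
  show ?thesis
    unfolding A_def wd_vf wd_simps ev_simps 1 2 by (simp add: ev_A[unfolded A_def] algebra_simps)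
qed

text \<open>Shifting \<open>v\<close> multiplies its generating sum at \<open>w\<close> by
  \<open>w\<close> or its inverse, so the total carries the factor
  \<open>1 + w + w\<^sup>2\<close>.\<close>

lemma sum_shift_geometric:
  fixes v :: "nat \<Rightarrow> complex"
  assumes w: "1 + w + w\<^sup>2 = 0" and v: "v 0 = 0" "v N = 0" "v (Suc N) = 0"
  shows "(\<Sum>i\<le>N. w ^ i * (v i + v (Suc i) + (case i of 0 \<Rightarrow> 0 | Suc j \<Rightarrow> v j))) = 0"
proof -
  let ?s = "\<Sum>i\<le>N. w ^ i * v i"
  have w0: "w \<noteq> 0" using w by auto
  have "w * (\<Sum>i\<le>N. w ^ i * v (Suc i)) = (\<Sum>i\<le>N. w ^ Suc i * v (Suc i))"
    by (simp add: sum_distrib_left mult.assoc)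
  also have "\<dots> = (\<Sum>i\<le>Suc N. w ^ i * v i)"
    by (subst sum.atMost_Suc_shift) (simp add: v)
  also have "\<dots> = ?s" by (simp add: v)
  finally have 1: "w * (\<Sum>i\<le>N. w ^ i * v (Suc i)) = ?s" .
  have 2: "(\<Sum>i\<le>N. w ^ i * (case i of 0 \<Rightarrow> 0 | Suc j \<Rightarrow> v j)) = w * ?s"
  proof (cases N)
    case (Suc M)
    then show ?thesis
      using v(2) unfolding Suc by (subst sum.atMost_Suc_shift) (simp add: sum_distrib_left mult.assoc)
  qed (simp add: v)
  have "w * (\<Sum>i\<le>N. w ^ i * (v i + v (Suc i) + (case i of 0 \<Rightarrow> 0 | Suc j \<Rightarrow> v j))) =
      w * ?s + ?s + w * (w * ?s)"
    by (simp only: distrib_left sum.distrib 1 2)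
  also have "\<dots> = (1 + w + w\<^sup>2) * ?s" by (simp add: algebra_simps power2_eq_square)
  finally show ?thesis using w w0 by simp
qed

text \<open>The second derivatives \<open>?h k l\<close> satisfy a three-term relation whose right
  side is a binomial coefficient times \<open>?c\<close>. Weighted with powers of a primitive cube
  root of unity, the left sides cancel and a nonzero multiple of \<open>?c\<close> remains.\<close>

lemma V_degree_3_mod_6:
  assumes x: "x \<in> Vs" and w: "weighted_degree (6 * int n + 3) (fn x)"
  shows "x = 0"
proof (rule V_degree_injective[OF x w])
  let ?d = "6 * n + 3"
  let ?h = "\<lambda>k l. ev 0 (wd (Du l) (wd (Du k) x))"
  let ?c = "ev 0 (wd (Du (?d - 1)) x)"
  have z_slope: "z_slope x = 0" using weight_linear_part(2)[OF x w] by simp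
  have "ev 0 (wd (Du 0) x) = 0" using weight_linear_part(1)[OF x w, of 0] by simp
  \<comment> \<open>The z-derivative lies in \<open>Vs\<close> and its linear parts vanish, so
    uniqueness removes all dependence on z.\<close>
  then have "wd Dz x = 0"
    using Vs_kap[OF x] Vs_first_order[OF x] z_slope
    by (intro Vs_uniqueness[OF Dz_in_Vs[OF x]])
       (auto simp: wd_commute[of _ Dz] Vs_dz_bar[OF x], metis not0_implies_Suc)
  then have Dz0: "ev z (DT (wd i (wd j x))) = 0" "ev z (DT (wd i x)) = 0" for i j z
    by (simp_all add: ev_DT wd_commute[of Dz])
  have h0: "?h l 0 = 0" "?h 0 l = 0" for l
    using Vs_first_order(2)[OF x, of 0 "Suc l"]
    by (simp_all add: wd_DT Dz0 wd_commute[of "Du l" "Du 0"])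
  have rel: "?h k l + (case l of 0 \<Rightarrow> 0 | Suc l' \<Rightarrow> ?h (Suc k) l') +
      (case k of 0 \<Rightarrow> 0 | Suc k' \<Rightarrow> ?h k' (Suc l)) =
      of_nat ((k + l + 2) choose Suc k) * ev 0 (wd (Du (k + l + 1)) x)" for k l
  proof -
    let ?b = "of_nat ((k + l + 2) choose Suc k) * ev 0 (wd (Du (k + l + 1)) x)"
    let ?r = "ev 0 (wd (Du 0) (wd (Du l) (wd (Du k) (DT x))))"
    let ?p = "ev 0 (wd (Du (Suc k)) (wd (Du l) (DT x))) + ev 0 (wd (Du (Suc l)) (wd (Du k) (DT x)))"
    have *: "m\<^sup>2 * ?b + m * ?p + ?r = m * ?h k l" if "m \<in> {1, -2}" for m
      using ev_wd_wd_A[of 0 l k m "DT x"] Vs_wd_A_DT[OF x that, of k]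
      by (simp add: wd_DT Dz0 mult.assoc)
    \<comment> \<open>Subtracting the two instances eliminates the third-order term.\<close>
    have lin: "b + h = p" 
      if "1\<^sup>2 * b + 1 * p + r = 1 * h" "(-2)\<^sup>2 * b + (-2) * p + r = (-2) * h" for b p r h :: complex
      using that by (auto simp: complex_eq_iff)
    have "?b + ?h k l = ?p"
      by (rule lin[OF *[of 1] *[of "-2"]]) simp_all
    moreover have "ev 0 (wd (Du (Suc k)) (wd (Du l) (DT x))) =
        ?h k l + (case l of 0 \<Rightarrow> 0 | Suc l' \<Rightarrow> ?h (Suc k) l')" for k l
      by (cases l) (simp_all add: wd_DT Dz0 wd_commute[of "Du (Suc k)"] wd_commute[of "Du k"])
    moreover have "?h l k = ?h k l" for k l by (simp add: wd_commute[of "Du l"])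
    ultimately have "?b = ?h k l + (case l of 0 \<Rightarrow> 0 | Suc l' \<Rightarrow> ?h (Suc k) l') +
        (case k of 0 \<Rightarrow> 0 | Suc k' \<Rightarrow> ?h (Suc l) k')"
      by (simp add: algebra_simps)
    also have "(case k of 0 \<Rightarrow> 0 | Suc k' \<Rightarrow> ?h (Suc l) k') = (case k of 0 \<Rightarrow> 0 | Suc k' \<Rightarrow> ?h k' (Suc l))"
      by (cases k) (simp_all add: wd_commute[of "Du (Suc l)"])
    finally show ?thesis by simp
  qed
  \<comment> \<open>The relevant indices satisfy \<open>k + l + 2 = ?d\<close>. The sequence
    \<open>v\<close> lists the second derivatives on this line and is padded by zero for the
    boundary index \<open>Suc N\<close>.\<close>
  define N where "N = ?d - 2"
  define v where "v i = (if i \<le> N then ?h i (N - i) else 0)" for i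
  have v: "v 0 = 0" "v N = 0" "v (Suc N) = 0" by (simp_all add: v_def h0)
  have vrel: "v i + v (Suc i) + (case i of 0 \<Rightarrow> 0 | Suc j \<Rightarrow> v j) = of_nat (?d choose Suc i) * ?c"
    if "i \<le> N" for i
  proof -
    have d: "i + (N - i) + 2 = ?d" "i + (N - i) + 1 = ?d - 1" using that by (auto simp: N_def)
    have 1: "(case N - i of 0 \<Rightarrow> 0 | Suc l' \<Rightarrow> ?h (Suc i) l') = v (Suc i)"
    proof (cases "i = N")
      case False
      then have "N - i = Suc (N - Suc i)" "Suc i \<le> N" using that by auto
      then show ?thesis by (simp add: v_def)
    qed (simp add: v)
    have 2: "(case i of 0 \<Rightarrow> 0 | Suc k' \<Rightarrow> ?h k' (Suc (N - i))) = (case i of 0 \<Rightarrow> 0 | Suc j \<Rightarrow> v j)"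
      using that by (cases i) (simp_all add: v_def Suc_diff_Suc Suc_le_eq)
    have "?h i (N - i) = v i" using that by (simp add: v_def)
    then show ?thesis
      using rel[where k = i and l = "N - i"] unfolding d 1 2 by simp
  qed
  \<comment> \<open>A primitive cube root of unity, hence a root of
    \<open>x\<^sup>2 + x y + y\<^sup>2\<close> at \<open>y = 1\<close>.\<close>
  define w where "w = Complex (-1/2) (sqrt 3 / 2)"
  have w: "1 + w + w\<^sup>2 = 0"
    by (simp add: w_def power2_eq_square complex_eq_iff)
  have w3: "w ^ 3 = 1"
  proof -
    have "(w - 1) * (1 + w + w\<^sup>2) = w ^ 3 - 1" by (simp add: algebra_simps power2_eq_square power3_eq_cube)
    then show ?thesis using w by simp
  qed
  have "w ^ 6 = 1" using power_mult[of w 3 2] w3 by simp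
  then have wd: "w ^ ?d = 1" by (simp add: power_add power_mult w3)
  have "1 + w = - (w\<^sup>2)" using w by (simp add: eq_neg_iff_add_eq_0)
  then have "(1 + w) ^ ?d = - ((w\<^sup>2) ^ ?d)" by (simp add: power_minus_odd)
  also have "(w\<^sup>2) ^ ?d = 1" by (simp only: power_mult[symmetric] mult.commute[of 2 ?d]) (simp only: power_mult wd power_one)
  finally have w1: "(1 + w) ^ ?d = -1" .
  have dN: "?d = Suc (Suc N)" by (simp add: N_def)
  have "(w + 1) ^ ?d = (\<Sum>i\<le>?d. of_nat (?d choose i) * w ^ i)"
    using binomial_ring[of w 1 ?d] by simp
  also have "\<dots> = 1 + w * (\<Sum>i\<le>N. w ^ i * of_nat (?d choose Suc i)) + w ^ ?d"
    unfolding dN by (subst sum.atMost_Suc_shift) (simp add: sum_distrib_left mult_ac del: binomial_Suc_Suc)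
  \<comment> \<open>The left side equals \<open>(1 + w) ^ ?d - 1 - w ^ ?d\<close>. Divisibility of
    the degree by 3 and its oddness give \<open>w ^ ?d = 1\<close> and
    \<open>(1 + w) ^ ?d = -1\<close>.\<close>
  finally have "w * (\<Sum>i\<le>N. w ^ i * of_nat (?d choose Suc i)) = -3"
    using w1 wd by (simp only: add.commute[of w 1]) (simp add: eq_neg_iff_add_eq_0 algebra_simps)
  moreover have "(\<Sum>i\<le>N. w ^ i * of_nat (?d choose Suc i)) * ?c = 0"
    unfolding sum_distrib_right
    using sum_shift_geometric[OF w v] by (simp add: vrel mult.assoc cong: sum.cong_simp)
  ultimately have "?c = 0" by auto
  then show "ev 0 (wd (Du (nat (6 * int n + 3 - 1))) x) = 0"
    by (simp add: nat_add_distrib nat_mult_distrib)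
qed auto

section \<open>Formal eigenfunctions and existence\<close>

unbundle no vec_syntax
unbundle fps_syntax

section \<open>Operations on formal series over the smooth functions\<close>

definition fps_map :: "(smf \<Rightarrow> smf) \<Rightarrow> smf fps \<Rightarrow> smf fps" where
  "fps_map d S = Abs_fps (\<lambda>n. d (S $ n))"

text \<open>Substitution of \<open>-X\<close> for \<open>X\<close>, that is, of -\<lambda> for
  \<lambda>, which passes from the linear problem to its dual.\<close>

definition fps_alt :: "smf fps \<Rightarrow> smf fps" where
  "fps_alt S = Abs_fps (\<lambda>n. if even n then S $ n else - (S $ n))"

lemma fps_map_nth [simp]: "fps_map d S $ n = d (S $ n)" and
  fps_alt_nth [simp]: "fps_alt S $ n = (if even n then S $ n else - (S $ n))"
  by (simp_all add: fps_map_def fps_alt_def)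

lemma fps_map_simps:
  assumes "derivation d"
  shows "fps_map d (S + S') = fps_map d S + fps_map d S'" "fps_map d (S - S') = fps_map d S - fps_map d S'"
    "fps_map d (- S) = - fps_map d S" "fps_map d (S * S') = fps_map d S * S' + S * fps_map d S'"
    "fps_map d fps_X = 0" "fps_map d 1 = 0" "fps_map d (numeral k) = 0" "fps_map d (fps_const c) = fps_const (d c)"
    "fps_map d (fps_alt S) = fps_alt (fps_map d S)"
  by (auto intro!: fps_ext simp: derivationD[OF assms] fps_mult_nth sum.distrib fps_X_def
      numeral_fps_const)

lemmas fps_map_e = fps_map_simps[OF derivation_e] and fps_map_eb = fps_map_simps[OF derivation_eb]

lemma fps_alt_simps: "fps_alt (S + S') = fps_alt S + fps_alt S'" "fps_alt (S - S') = fps_alt S - fps_alt S'" "fps_alt (- S) = - fps_alt S"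
  "fps_alt (S * S') = fps_alt S * fps_alt S'" "fps_alt fps_X = - fps_X" "fps_alt 1 = 1" "fps_alt (numeral k) = numeral k"
  "fps_alt (fps_const c) = fps_const c" "fps_alt (fps_alt S) = S"
proof -
  show "fps_alt (S * S') = fps_alt S * fps_alt S'"
  proof (rule fps_ext)
    fix n
    have "(if even n then S $ i * S' $ (n - i) else - (S $ i * S' $ (n - i))) = fps_alt S $ i * fps_alt S' $ (n - i)"
      if "i \<le> n" for i
      using that by (auto simp: even_diff_nat)
    then show "fps_alt (S * S') $ n = (fps_alt S * fps_alt S') $ n"
      unfolding fps_alt_nth fps_mult_nth sum_negf[symmetric] by (cases "even n") (auto intro!: sum.cong)
  qed
qed (auto intro!: fps_ext simp: fps_X_def numeral_fps_const)

section \<open>The formal eigenfunction and its Riccati equations\<close>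

fun YK :: "nat \<Rightarrow> smf \<times> smf" where
  "YK 0 = (1, 1)"
| "YK (Suc n) =
    (let a = e (fst (YK n)) - W 0 * fst (YK n) + (\<Sum>j\<in>{1..n}. fst (YK j) * fst (YK (Suc n - j)));
         b = 2 * W 0 * snd (YK n) - e (snd (YK n)) - (\<Sum>j\<in>{1..n}. snd (YK j) * fst (YK (Suc n - j)))
     in (Cn (1/3) * (b - a), Cn (1/3) * (a + 2 * b)))"

declare YK.simps(2) [simp del]

text \<open>Here \<open>Y = \<psi>\<^sub>1 / (\<lambda> \<psi>\<^sub>0)\<close> and \<open>K = \<psi>\<^sub>2 / (\<lambda>\<^sup>2 \<psi>\<^sub>0)\<close> as formal series in \<open>1 / \<lambda>\<close> for the
  eigenfunction \<open>\<psi>\<close> of the linear problem \<open>\<partial>\<psi>\<^sub>0 = \<psi>\<^sub>1 - u\<^sub>0\<psi>\<^sub>0\<close>, \<open>\<partial>\<psi>\<^sub>1 = \<psi>\<^sub>2\<close>,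
  \<open>\<partial>\<psi>\<^sub>2 = \<lambda>\<^sup>3 \<psi>\<^sub>0 + u\<^sub>0\<psi>\<^sub>2\<close>.\<close>

definition Y :: "smf fps" where "Y = Abs_fps (\<lambda>n. fst (YK n))"
definition K :: "smf fps" where "K = Abs_fps (\<lambda>n. snd (YK n))"

definition w0 :: "smf fps" where "w0 = fps_const (W 0)"
definition E1 :: "smf fps" where "E1 = fps_const (Exu 1)"
definition E2 :: "smf fps" where "E2 = fps_const (Exu (- 2))"
abbreviation "X \<equiv> fps_X :: smf fps"

lemma YK_0 [simp]: "Y $ 0 = 1" "K $ 0 = 1"
  by (simp_all add: Y_def K_def)

lemma sum_ends: "(\<Sum>j=0..Suc n. g j) = g 0 + g (Suc n) + (\<Sum>j\<in>{1..n}. g j :: 'a :: comm_monoid_add)"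
proof -
  have "{0..Suc n} = insert 0 (insert (Suc n) {1..n})" by auto
  then show ?thesis by (simp add: add.assoc)
qed

text \<open>The unknowns of index \<open>Suc n\<close> enter the two Riccati equations linearly, as
  \<open>K - 2 Y = a\<close> and \<open>K + Y = b\<close>. The determinant 3 of this system explains
  the factors 1/3 in \<open>YK\<close>.\<close>

lemma YK_Suc:
  "K $ Suc n - (Y * Y) $ Suc n + W 0 * Y $ n = e (Y $ n)"
  "2 * W 0 * K $ n - (K * Y) $ Suc n = e (K $ n)"
proof -
  define a where "a = e (Y $ n) - W 0 * Y $ n + (\<Sum>j\<in>{1..n}. Y $ j * Y $ (Suc n - j))"
  define b where "b = 2 * W 0 * K $ n - e (K $ n) - (\<Sum>j\<in>{1..n}. K $ j * Y $ (Suc n - j))"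
  have YK: "Y $ Suc n = Cn (1/3) * (b - a)" "K $ Suc n = Cn (1/3) * (a + 2 * b)"
    by (simp_all add: Y_def K_def YK.simps(2) Let_def a_def b_def)
  have third: "Cn (1/3) * (3 * x) = x" for x
    by (rule smf_eqI) simp
  have "K $ Suc n - 2 * Y $ Suc n = Cn (1/3) * (3 * a)" "K $ Suc n + Y $ Suc n = Cn (1/3) * (3 * b)"
    unfolding YK by (simp_all add: algebra_simps)
  then have eqs: "K $ Suc n - 2 * Y $ Suc n = a" "K $ Suc n + Y $ Suc n = b"
    unfolding third .
  show "K $ Suc n - (Y * Y) $ Suc n + W 0 * Y $ n = e (Y $ n)"
    using eqs(1) unfolding fps_mult_nth sum_ends a_def by (simp add: algebra_simps)
  show "2 * W 0 * K $ n - (K * Y) $ Suc n = e (K $ n)"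
    using eqs(2) unfolding fps_mult_nth sum_ends b_def by (simp add: algebra_simps)
qed

text \<open>The quotient rule for \<open>Y\<close>, multiplied by \<open>X\<close> = 1/\<lambda> to
  clear the positive power of \<lambda>.\<close>

lemma Y_eq: "X * fps_map e Y = K - Y * Y + X * w0 * Y"
proof (rule fps_ext)
  fix n show "(X * fps_map e Y) $ n = (K - Y * Y + X * w0 * Y) $ n"
    using YK_Suc(1)[of "n - 1"] by (cases n) (simp_all add: w0_def mult.assoc)
qed

lemma K_eq: "X * fps_map e K = 1 - K * Y + 2 * X * w0 * K"
proof (rule fps_ext)
  have two: "2 * X * w0 * K = X * (w0 * K) + X * (w0 * K)"
    by (simp only: mult_2 mult.assoc distrib_right)
  fix n show "(X * fps_map e K) $ n = (1 - K * Y + 2 * X * w0 * K) $ n"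
  proof (cases n)
    case (Suc m)
    have "W 0 * K $ m + W 0 * K $ m = 2 * W 0 * K $ m"
      by (simp only: mult_2 distrib_right)
    then have "(1 - K * Y + (X * (w0 * K) + X * (w0 * K))) $ Suc m = 2 * W 0 * K $ m - (K * Y) $ Suc m"
      by (simp add: w0_def)
    then show ?thesis unfolding Suc two YK_Suc(2) by simp
  qed (simp add: two)
qed

lemma e_exp_series: "fps_map e E1 = w0 * E1" "fps_map e E2 = - 2 * w0 * E2"
  by (auto intro!: fps_ext simp: E1_def E2_def w0_def Cn_hom numeral_fps_const mult.assoc)

lemma eb_w0: "fps_map eb w0 = - (E1 - E2)"
  by (auto intro!: fps_ext simp: E1_def E2_def w0_def Tm_def)

lemma fps_alt_consts: "fps_alt w0 = w0" "fps_alt E1 = E1" "fps_alt E2 = E2"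
  by (simp_all add: E1_def E2_def w0_def fps_alt_simps)

lemma mult_nth_leading: "(\<And>m. m < n \<Longrightarrow> S' $ m = 0) \<Longrightarrow> (S * S') $ n = S $ 0 * (S' $ n :: smf)"
proof -
  assume z: "\<And>m. m < n \<Longrightarrow> S' $ m = 0"
  have "(S * S') $ n = (\<Sum>i\<in>{0}. S $ i * S' $ (n - i))"
    unfolding fps_mult_nth by (rule sum.mono_neutral_right) (auto simp: z)
  then show ?thesis by simp
qed

lemma fps_map_commute: "fps_map e (fps_map eb S) = fps_map eb (fps_map e S)"
  by (rule fps_ext) (simp add: e_eb_commute)

text \<open>\<open>R\<close> and \<open>S\<close> measure the failure of the claims. Since
  \<open>e\<close> and \<open>eb\<close> commute, they obey a homogeneous linear system. At the
  lowest order not yet known to vanish it reads \<open>S - 2 R = 0\<close>,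
  \<open>S + R = 0\<close>, which has only the zero solution.\<close>

lemma eb_YK: "fps_map eb Y = - X * (E1 - E2 * Y * K)" "fps_map eb K = - X * (E1 * Y - E2 * K * K)"
proof -
  define R where "R = fps_map eb Y + X * (E1 - E2 * Y * K)"
  define S where "S = fps_map eb K + X * (E1 * Y - E2 * K * K)"
  have ebY: "fps_map eb Y = R - X * (E1 - E2 * Y * K)" and ebK: "fps_map eb K = S - X * (E1 * Y - E2 * K * K)"
    by (simp_all add: R_def S_def)
  have "X * fps_map e (fps_map eb Y) = fps_map eb (X * fps_map e Y)"
    by (simp add: fps_map_commute fps_map_eb)
  also have "\<dots> = fps_map eb K - 2 * Y * fps_map eb Y + X * (w0 * fps_map eb Y - (E1 - E2) * Y)"
    unfolding Y_eq by (simp add: fps_map_eb(1-7) eb_w0 algebra_simps)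
  finally have XY: "X * fps_map e (fps_map eb Y) = \<dots>" .
  have "X * fps_map e (fps_map eb K) = fps_map eb (X * fps_map e K)"
    by (simp add: fps_map_commute fps_map_eb)
  also have "\<dots> = - (fps_map eb K * Y + K * fps_map eb Y) + 2 * X * (w0 * fps_map eb K - (E1 - E2) * K)"
    unfolding K_eq by (simp add: fps_map_eb(1-7) eb_w0 algebra_simps)
  finally have XK: "X * fps_map e (fps_map eb K) = \<dots>" .
  have R: "X * fps_map e R = S - 2 * Y * R + X * w0 * R"
  proof -
    have "X * fps_map e R = X * fps_map e (fps_map eb Y) + X * (X * (w0 * E1 + 2 * w0 * E2 * Y * K)
        - E2 * (X * fps_map e Y * K + Y * (X * fps_map e K)))"
      by (simp add: R_def fps_map_e(1-7) e_exp_series algebra_simps)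
    also have "\<dots> = S - 2 * Y * R + X * w0 * R"
      unfolding XY unfolding Y_eq K_eq ebY ebK by (simp add: algebra_simps)
    finally show ?thesis .
  qed
  have S: "X * fps_map e S = - Y * S - K * R + 2 * X * w0 * S"
  proof -
    have "X * fps_map e S = X * fps_map e (fps_map eb K) + X * (X * (w0 * E1 * Y + 2 * w0 * E2 * K * K)
        + E1 * (X * fps_map e Y) - 2 * E2 * K * (X * fps_map e K))"
      by (simp add: S_def fps_map_e(1-7) e_exp_series algebra_simps)
    also have "\<dots> = - Y * S - K * R + 2 * X * w0 * S"
      unfolding XK unfolding Y_eq K_eq ebY ebK by (simp add: algebra_simps)
    finally show ?thesis .
  qed
  have "R $ n = 0 \<and> S $ n = 0" for n
  proof (induction n rule: less_induct)
    case (less n)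
    have XR: "(X * (Q * R')) $ n = 0" if "R' = R \<or> R' = S" for Q R'
      using that less mult_nth_leading[of _ R' Q] by (cases n) auto
    have e0: "(X * fps_map e R) $ n = 0" "(X * fps_map e S) $ n = 0"
      using less by (cases n; simp)+
    have "S $ n - 2 * R $ n = 0"
    proof -
      have "(Y * R) $ n = R $ n" using mult_nth_leading[of n R Y] less by simp
      moreover have "(X * fps_map e R) $ n = S $ n - 2 * (Y * R) $ n + (X * (w0 * R)) $ n"
        unfolding R by (simp add: numeral_fps_const mult.assoc)
      ultimately show ?thesis using e0 XR[of R w0] by simp
    qed
    moreover have "S $ n + R $ n = 0"
    proof -
      have "(Y * S) $ n = S $ n" "(K * R) $ n = R $ n"
        using mult_nth_leading[of n S Y] mult_nth_leading[of n R K] less by simp_all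
      moreover have "(X * fps_map e S) $ n = - (Y * S) $ n - (K * R) $ n + 2 * (X * (w0 * S)) $ n"
        unfolding S by (simp add: numeral_fps_const mult.assoc)
      ultimately show ?thesis using e0 XR[of S w0] by (simp add: algebra_simps)
    qed
    ultimately have "3 * R $ n = 0" "S $ n = - (R $ n)"
      by (simp_all add: eq_neg_iff_add_eq_0 algebra_simps)
    then show ?case by (simp add: numeral_cancel)
  qed
  then have "R = 0" "S = 0" by (auto intro: fps_ext)
  with ebY ebK show "fps_map eb Y = - X * (E1 - E2 * Y * K)" "fps_map eb K = - X * (E1 * Y - E2 * K * K)"
    by simp_all
qed

text \<open>\<open>fps_alt Y\<close> and \<open>fps_alt K\<close> belong to the dual eigenfunction \<open>\<psi>\<^sup>*\<close>; up to a common factor, \<open>fps_alt K\<close>,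
  \<open>Y * fps_alt Y\<close> and \<open>K\<close> are the products \<open>\<psi>\<^sub>i \<psi>\<^sup>*\<^sub>i\<close>, whose sum is constant along the flow.\<close>

definition Ns where "Ns = fps_alt K + Y * fps_alt Y + K"
definition hs where "hs = fps_right_inverse Ns (Cn (1/3))"
definition Gs where "Gs = (fps_alt K - K) * hs"

text \<open>The constant term of \<open>Ns\<close> is 3, the sum of three leading coefficients 1;
  hence the initial value 1/3 of the inverse.\<close>

lemma Ns_hs: "Ns * hs = 1"
  unfolding hs_def by (rule fps_right_inverse) (auto intro!: smf_eqI simp: Ns_def)

lemma inverse_derivative:
  assumes "derivation d" shows "fps_map d hs = - fps_map d Ns * hs * hs"
proof -
  note d = fps_map_simps[OF assms]
  have "fps_map d Ns * hs + Ns * fps_map d hs = 0"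
    using Ns_hs[THEN arg_cong[of _ _ "fps_map d"]] by (simp add: d)
  then have "hs * (fps_map d Ns * hs) + (Ns * hs) * fps_map d hs = 0"
    by (metis distrib_left mult.assoc mult.commute mult_zero_right)
  then show ?thesis unfolding Ns_hs by (simp add: eq_neg_iff_add_eq_0 algebra_simps)
qed

lemma dual_eqs:
  "X * fps_map e (fps_alt Y) = fps_alt Y * fps_alt Y - fps_alt K + X * w0 * fps_alt Y"
  "X * fps_map e (fps_alt K) = fps_alt K * fps_alt Y - 1 + 2 * X * w0 * fps_alt K"
  "fps_map eb (fps_alt Y) = X * (E1 - E2 * fps_alt Y * fps_alt K)"
  "fps_map eb (fps_alt K) = X * (E1 * fps_alt Y - E2 * fps_alt K * fps_alt K)"
proof -
  show "X * fps_map e (fps_alt Y) = fps_alt Y * fps_alt Y - fps_alt K + X * w0 * fps_alt Y"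
    using Y_eq[THEN arg_cong[of _ _ "\<lambda>x. - fps_alt x"]] by (simp add: fps_alt_simps fps_alt_consts fps_map_e)
  show "X * fps_map e (fps_alt K) = fps_alt K * fps_alt Y - 1 + 2 * X * w0 * fps_alt K"
    using K_eq[THEN arg_cong[of _ _ "\<lambda>x. - fps_alt x"]] by (simp add: fps_alt_simps fps_alt_consts fps_map_e)
  show "fps_map eb (fps_alt Y) = X * (E1 - E2 * fps_alt Y * fps_alt K)" "fps_map eb (fps_alt K) = X * (E1 * fps_alt Y - E2 * fps_alt K * fps_alt K)"
    by (simp_all add: fps_map_eb eb_YK fps_alt_simps fps_alt_consts)
qed

text \<open>\<open>th\<close> is \<open>X\<close> times the logarithmic \<open>e\<close>-derivative
  of \<open>Ns\<close>. It enters the derivatives of \<open>Q\<close> and \<open>hs\<close> with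
  opposite signs and cancels. The factor \<open>X\<close> in \<open>ebG\<close> is what allows the
  Riccati equations to be used without dividing by \<open>X\<close>.\<close>

lemma Gs_eq: "fps_map e (fps_map eb Gs) = - (E1 + 2 * E2) * Gs"
proof -
  define Y' where "Y' = fps_alt Y"
  define K' where "K' = fps_alt K"
  note eqs = Y_eq K_eq dual_eqs(1,2)[folded Y'_def K'_def]
  note ebs = eb_YK dual_eqs(3,4)[folded Y'_def K'_def]
  define th where "th = Y' - Y + 2 * X * w0"
  define Q where "Q = E1 * (Y + Y') - 2 * E2 * K * K'"
  have N: "Ns = K' + Y * Y' + K" by (simp add: Ns_def Y'_def K'_def)
  have "X * fps_map e Ns = X * fps_map e K' + (X * fps_map e Y) * Y' + Y * (X * fps_map e Y') + X * fps_map e K"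
    by (simp add: N fps_map_e algebra_simps)
  also have "\<dots> = Ns * th"
    unfolding eqs by (simp add: N th_def algebra_simps)
  finally have eN: "X * fps_map e Ns = Ns * th" .
  have "X * fps_map e hs = - (X * fps_map e Ns) * hs * hs"
    by (simp add: inverse_derivative[OF derivation_e] algebra_simps)
  also have "\<dots> = - ((Ns * hs) * th * hs)"
    unfolding eN by (simp add: algebra_simps)
  finally have eh: "X * fps_map e hs = - (th * hs)" by (simp add: Ns_hs)
  have ebN: "fps_map eb Ns = X * E2 * (K - K') * Ns"
    by (simp add: N fps_map_eb(1-7) ebs algebra_simps)
  have "fps_map eb hs = - (X * E2 * (K - K') * (Ns * hs) * hs)"
    unfolding inverse_derivative[OF derivation_eb] ebN by (simp add: algebra_simps)
  then have ebh: "fps_map eb hs = - (X * E2 * (K - K') * hs)"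
    by (simp add: Ns_hs)
  have ebG: "fps_map eb Gs = X * (Q * hs)"
    by (simp add: Gs_def K'_def[symmetric] fps_map_eb(1-7) ebs ebh Q_def algebra_simps)
  have eQ: "X * fps_map e Q = Q * th - (E1 + 2 * E2) * (K' - K)"
  proof -
    have "X * fps_map e Q = X * w0 * E1 * (Y + Y') + E1 * (X * fps_map e Y + X * fps_map e Y') + 4 * X * w0 * E2 * K * K'
        - 2 * E2 * ((X * fps_map e K) * K' + K * (X * fps_map e K'))"
      by (simp add: Q_def fps_map_e(1-7) e_exp_series algebra_simps)
    also have "\<dots> = Q * th - (E1 + 2 * E2) * (K' - K)"
      unfolding eqs by (simp add: Q_def th_def algebra_simps)
    finally show ?thesis .
  qed
  have "fps_map e (fps_map eb Gs) = (X * fps_map e Q) * hs + Q * (X * fps_map e hs)"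
    unfolding ebG by (simp add: fps_map_e algebra_simps)
  also have "\<dots> = - (E1 + 2 * E2) * ((K' - K) * hs)"
    unfolding eQ eh by (simp add: algebra_simps)
  finally show ?thesis by (simp add: Gs_def K'_def)
qed

lemma Gs_Eop: "Eop (Gs $ n) = 0"
proof -
  have "E1 + 2 * E2 = fps_const (Exu 1 + 2 * Exu (- 2))"
    by (rule fps_ext) (simp add: E1_def E2_def numeral_fps_const)
  then have "fps_map e (fps_map eb Gs) $ n = - ((Exu 1 + 2 * Exu (- 2)) * Gs $ n)"
    by (simp only: Gs_eq mult_minus_left fps_neg_nth fps_mult_left_const_nth)
  then show ?thesis by (simp only: Eop_def fps_map_nth e_eb_commute) simp
qed

section \<open>Weights of the series coefficients\<close>

definition weighted_series :: "smf fps \<Rightarrow> bool" where "weighted_series S \<longleftrightarrow> (\<forall>n. hpol n (S $ n))"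

lemma weighted_series_simps: "weighted_series S \<Longrightarrow> weighted_series S' \<Longrightarrow> weighted_series (S + S')" "weighted_series S \<Longrightarrow> weighted_series S' \<Longrightarrow> weighted_series (S - S')"
  "weighted_series S \<Longrightarrow> weighted_series S' \<Longrightarrow> weighted_series (S * S')" "weighted_series S \<Longrightarrow> weighted_series (fps_alt S)"
  by (auto simp: weighted_series_def hpol_simps hpol.add fps_mult_nth intro!: hpol_sum intro: hpol_mult')

lemma hpol_YK: "hpol n (fst (YK n)) \<and> hpol n (snd (YK n))"
proof (induction n rule: less_induct)
  case (less n)
  show ?case
  proof (cases n)
    case 0
    then show ?thesis by (simp add: hpol_simps)
  next
    case (Suc m)
    have IH: "hpol m (fst (YK m))" "hpol m (snd (YK m))" using less[of m] by (auto simp: Suc)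
    have W: "hpol (Suc m) (W 0 * x)" if "hpol m x" for x
      by (rule hpol_mult'[OF hpol.gen that]) simp
    have two: "hpol (Suc m) (2 * x)" if "hpol (Suc m) x" for x
      using hpol_simps(3)[OF that, of 2] by simp
    have sum: "hpol (Suc m) (\<Sum>j\<in>{1..m}. g (YK j) * fst (YK (Suc m - j)))"
      if "g = fst \<or> g = snd" for g
    proof (rule hpol_sum)
      fix j assume "j \<in> {1..m}"
      then show "hpol (Suc m) (g (YK j) * fst (YK (Suc m - j)))"
        using that less[of j] less[of "Suc m - j"]
        by (intro hpol_mult'[of j _ "Suc m - j"]) (auto simp: Suc)
    qed
    have a: "hpol (Suc m) (e (fst (YK m)) - W 0 * fst (YK m)
        + (\<Sum>j\<in>{1..m}. fst (YK j) * fst (YK (Suc m - j))))"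
      using IH W sum[of fst] by (intro hpol.add hpol_simps(2) hpol_e) auto
    have b: "hpol (Suc m) (2 * (W 0 * snd (YK m)) - e (snd (YK m))
        - (\<Sum>j\<in>{1..m}. snd (YK j) * fst (YK (Suc m - j))))"
      using IH W sum[of snd] by (intro two hpol_simps(2) hpol_e) auto
    have "hpol (Suc m) (Cn (1/3) * (y - x))" "hpol (Suc m) (Cn (1/3) * (x + 2 * y))"
      if "hpol (Suc m) x" "hpol (Suc m) y" for x y
      using that by (auto intro: hpol_scale hpol.add hpol_simps(2) two)
    from this[OF a b] show ?thesis
      by (simp only: Suc YK.simps Let_def fst_conv snd_conv mult.assoc[of 2] simp_thms)
  qed
qed

lemma weighted_series_YK: "weighted_series Y" "weighted_series K"
  using hpol_YK by (auto simp: weighted_series_def Y_def K_def)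

lemma weighted_series_Ns: "weighted_series Ns"
  by (simp add: Ns_def weighted_series_simps weighted_series_YK)

lemma weighted_series_hs: "weighted_series hs"
proof -
  have "hpol n (hs $ n)" for n
  proof (induction n rule: less_induct)
    case (less n)
    have "(1 :: smf fps) $ n = (\<Sum>i=0..n. Ns $ i * hs $ (n - i))"
      unfolding Ns_hs[symmetric] fps_mult_nth ..
    also have "\<dots> = 3 * hs $ n + (\<Sum>i\<in>{1..n}. Ns $ i * hs $ (n - i))"
      by (simp add: sum.atLeast_Suc_atMost Ns_def)
    finally have "3 * hs $ n = 1 $ n - (\<Sum>i\<in>{1..n}. Ns $ i * hs $ (n - i))"
      by (simp add: algebra_simps)
    moreover have "hpol n (Ns $ i * hs $ (n - i))" if "i \<in> {1..n}" for i
      using weighted_series_Ns less[of "n - i"] that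
      by (intro hpol_mult'[of i _ "n - i"]) (auto simp: weighted_series_def)
    then have "hpol n (1 $ n - (\<Sum>i\<in>{1..n}. Ns $ i * hs $ (n - i)))"
      by (intro hpol_simps(2) hpol_sum) (auto simp: hpol_simps hpol.zero)
    ultimately have "hpol n (Cn (1/3) * (3 * hs $ n))" by (simp only: hpol_scale)
    moreover have "Cn (1/3) * (3 * hs $ n) = hs $ n" by (rule smf_eqI) simp
    ultimately show ?case by simp
  qed
  then show ?thesis by (simp add: weighted_series_def)
qed

lemma weighted_series_Gs: "weighted_series Gs"
  by (simp add: Gs_def weighted_series_simps weighted_series_YK weighted_series_hs)

lemma hpol_weighted_degree: "hpol w x \<Longrightarrow> weighted_degree (int w) (fn x)"
proof -
  assume "hpol w x"
  then have "fn x (F l p) = l ^ w * fn x p" for l p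
    by (induction rule: hpol.induct)
       (simp_all add: F_def jw_def algebra_simps power_add)
  then show ?thesis by (simp add: weighted_degree_def power_int_of_nat)
qed

lemma Gs_in_Vs: "Gs $ n \<in> Vs"
proof -
  have h: "hpol n (Gs $ n)" using weighted_series_Gs by (simp add: weighted_series_def)
  have "wd DU (Gs $ n) = 0" "wd (Dub j) (Gs $ n) = 0" for j
    by (rule wd_hpol_0[OF h], blast)+
  then show ?thesis by (simp add: Vs_def Gs_Eop)
qed

lemma Gs_weighted_degree: "weighted_degree (int n) (fn (Gs $ n))"
  using hpol_weighted_degree weighted_series_Gs by (simp add: weighted_series_def)

section \<open>Linear parts of the series coefficients\<close>

definition lin :: "nat \<Rightarrow> smf fps \<Rightarrow> complex" where "lin k S = ev 0 (wd (Du k) (S $ Suc k))"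

lemma lin_simps: "lin k (S + S') = lin k S + lin k S'" "lin k (S - S') = lin k S - lin k S'"
  "lin k (fps_alt S) = (if even k then - lin k S else lin k S)"
  by (simp_all add: lin_def)

text \<open>By weight, u_k occurs linearly only in the coefficient of index \<open>Suc k\<close>,
  and constants only in that of index 0; so \<open>lin k\<close> is a derivation over the constant
  terms.\<close>

lemma lin_mult:
  assumes "weighted_series S" "weighted_series S'"
  shows "lin k (S * S') = ev 0 (S $ 0) * lin k S' + lin k S * ev 0 (S' $ 0)"
proof -
  have ev0: "ev 0 (S $ i) = 0" "ev 0 (S' $ i) = 0" if "i > 0" for i
    using assms that by (auto simp: weighted_series_def intro: ev_hpol)
  have wd0: "wd (Du k) (S $ 0) = 0" "wd (Du k) (S' $ 0) = 0"
    using assms by (auto simp: weighted_series_def intro: wd_hpol_high)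
  have "lin k (S * S') = (\<Sum>i=0..Suc k. ev 0 (wd (Du k) (S $ i)) * ev 0 (S' $ (Suc k - i)) +
      ev 0 (S $ i) * ev 0 (wd (Du k) (S' $ (Suc k - i))))"
    by (simp add: lin_def fps_mult_nth del: sum.cl_ivl_Suc)
  also have "\<dots> = ev 0 (S $ 0) * lin k S' + lin k S * ev 0 (S' $ 0)"
    unfolding sum_ends by (simp add: ev0 wd0 lin_def)
  finally show ?thesis .
qed

lemma e_hpol: "hpol w x \<Longrightarrow> e x = DT x"
proof -
  assume h: "hpol w x"
  have "wd DU x = 0" "\<And>j. wd (Dub j) x = 0" by (rule wd_hpol_0[OF h], blast)+
  moreover from this have "Ab m x = 0" for m
    using A_eq_0[of "cj x" m] by (simp add: wd_cj cj_DA(3)[of m "cj _", simplified, symmetric])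
  ultimately show ?thesis by (simp add: e_split)
qed

text \<open>The total derivative sends u_k to u_(k+1), and the factor \<open>X\<close> moves the
  series index along with it.\<close>

lemma lin_X_e:
  assumes "weighted_series S"
  shows "lin 0 (X * fps_map e S) = 0" "lin (Suc k) (X * fps_map e S) = lin k S"
proof -
  have h: "hpol n (S $ n)" for n using assms by (simp add: weighted_series_def)
  then have D: "e (S $ n) = DT (S $ n)" "wd Dz (S $ n) = 0" for n
    using e_hpol wd_hpol_0[OF h, of Dz] by blast+
  show "lin 0 (X * fps_map e S) = 0" "lin (Suc k) (X * fps_map e S) = lin k S"
    by (simp_all add: lin_def D wd_DT ev_DT wd_commute[of Dz])
qed

lemma lin_X_w0:
  assumes "weighted_series S"
  shows "lin k (X * w0 * S) = (if k = 0 then ev 0 (S $ 0) else 0)"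
  by (simp add: lin_def w0_def mult.assoc)

text \<open>Taking linear parts turns the Riccati equations into a two-dimensional linear
  recursion.\<close>

lemma lin_YK_0: "lin 0 Y = 1" "lin 0 K = 1"
  and lin_YK_Suc: "lin (Suc k) Y = - (lin k Y + lin k K) / 3" "lin (Suc k) K = (lin k Y - 2 * lin k K) / 3"
proof -
  have two: "lin k (2 * S) = 2 * lin k S" for k S
    by (simp add: lin_def numeral_fps_const)
  have 1: "lin k 1 = 0" for k by (simp add: lin_def)
  have Y: "lin k (X * fps_map e Y) = lin k K - 2 * lin k Y + (if k = 0 then 1 else 0)" for k
    unfolding Y_eq lin_simps lin_X_w0[OF weighted_series_YK(1)] by (simp add: lin_mult weighted_series_YK)
  have K: "lin k (X * fps_map e K) = - lin k K - lin k Y + (if k = 0 then 2 else 0)" for k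
    unfolding K_eq lin_simps mult.assoc[of 2] two lin_X_w0[OF weighted_series_YK(2)]
    by (simp add: lin_mult weighted_series_YK 1)
  have "lin 0 K - 2 * lin 0 Y + 1 = 0" "- lin 0 K - lin 0 Y + 2 = 0"
    using Y[of 0] K[of 0] by (simp_all add: lin_X_e weighted_series_YK)
  then show "lin 0 Y = 1" "lin 0 K = 1" by (auto simp: complex_eq_iff)
  have "lin (Suc k) K - 2 * lin (Suc k) Y = lin k Y" "- lin (Suc k) K - lin (Suc k) Y = lin k K"
    using Y[of "Suc k"] K[of "Suc k"] by (simp_all add: lin_X_e weighted_series_YK)
  then show "lin (Suc k) Y = - (lin k Y + lin k K) / 3" "lin (Suc k) K = (lin k Y - 2 * lin k K) / 3"
    by (auto simp: complex_eq_iff)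
qed

text \<open>The recursion matrix has eigenvalues of modulus 1/sqrt 3 and arguments 5 pi/6 and -5
  pi/6, so its sixth power is the scalar -1/27.\<close>

lemma lin_YK_period: "lin (6 * m) Y = (-1/27) ^ m \<and> lin (6 * m) K = (-1/27) ^ m"
proof (induction m)
  case (Suc m)
  have "6 * Suc m = Suc (Suc (Suc (Suc (Suc (Suc (6 * m))))))" by simp
  then show ?case using Suc by (simp only: lin_YK_Suc) (simp add: field_simps)
qed (simp add: lin_YK_0)

lemma lin_K_nonzero: "lin (6 * m) K \<noteq> 0" "lin (6 * m + 4) K \<noteq> 0"
proof -
  show "lin (6 * m) K \<noteq> 0" using lin_YK_period[of m] by simp
  have "6 * m + 4 = Suc (Suc (Suc (Suc (6 * m))))" by simp
  then have "lin (6 * m + 4) K = - ((-1/27) ^ m) / 9"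
    using lin_YK_period[of m] by (simp only: lin_YK_Suc) (simp add: field_simps)
  then show "lin (6 * m + 4) K \<noteq> 0" by simp
qed

text \<open>Linear part of \<open>Ns * Gs = fps_alt K - K\<close>, where the constant terms are 3
  and 0; for even \<open>k\<close> the index \<open>Suc k\<close> is odd and \<open>fps_alt\<close>
  changes the sign.\<close>

lemma lin_Gs: "even k \<Longrightarrow> 3 * lin k Gs = - 2 * lin k K"
proof -
  assume k: "even k"
  have "Ns * Gs = (fps_alt K - K) * (Ns * hs)" by (simp add: Gs_def algebra_simps)
  then have "lin k (Ns * Gs) = - 2 * lin k K" by (simp add: Ns_hs lin_simps k)
  moreover have "ev 0 (Gs $ 0) = 0" "ev 0 (Ns $ 0) = 3" by (simp_all add: Gs_def Ns_def)
  ultimately show ?thesis by (simp add: lin_mult weighted_series_Ns weighted_series_Gs)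
qed

lemma Gs_nonzero: "ev 0 (wd (Du (6 * m)) (Gs $ (6 * m + 1))) \<noteq> 0"
  "ev 0 (wd (Du (6 * m + 4)) (Gs $ (6 * m + 5))) \<noteq> 0"
proof -
  have eq: "6 * m + 1 = Suc (6 * m)" "6 * m + 5 = Suc (6 * m + 4)" by simp_all
  show "ev 0 (wd (Du (6 * m)) (Gs $ (6 * m + 1))) \<noteq> 0"
    using lin_Gs[of "6 * m"] lin_K_nonzero(1)[of m] unfolding eq lin_def[symmetric] by auto
  show "ev 0 (wd (Du (6 * m + 4)) (Gs $ (6 * m + 5))) \<noteq> 0"
    using lin_Gs[of "6 * m + 4"] lin_K_nonzero(2)[of m] unfolding eq lin_def[symmetric] by auto
qed

section \<open>The infinitesimal rotation of the z-plane in degree 0\<close>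

definition rot :: smf where "rot = Z * W 0 - cj (Z * W 0)"

text \<open>Rotations preserve the equation. In the computation, the two terms in f without a factor
  z cancel because f is real.\<close>

lemma rot_in_Vs: "rot \<in> Vs"
proof -
  have "wd DU (Tm 1) = Exu 1 * W 0 - 4 * Exu (-2) * W 0"
    by (simp add: wd_DU_Tm bell.simps Cn_hom)
  then show ?thesis
    by (simp add: Vs_def rot_def Eop_def Tm_def bell.simps Cn_hom algebra_simps)
qed

lemma rot_weighted_degree: "weighted_degree 0 (fn rot)"
proof -
  have "cnj l * l = 1" if "cmod l = 1" for l
    using that by (simp add: complex_norm_square[symmetric] mult.commute)
  then have "cnj (inverse l) * cnj l = 1" "inverse l * l = 1" if "cmod l = 1" for l
    using that by (auto simp: field_simps)
  then show ?thesis
    by (auto simp: weighted_degree_def rot_def F_def jz_def jw_def field_simps)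
qed

lemma z_slope_rot: "z_slope rot = 1"
  by (simp add: z_slope_def rot_def)

lemma z_slope_linear: "z_slope (x + y) = z_slope x + z_slope y" "z_slope (Cn c * x) = c * z_slope x"
  by (simp_all add: z_slope_def)

section \<open>Dimensions of the graded pieces and conjugation\<close>

lemma V_deg_iff: "P \<in> V_deg d \<longleftrightarrow> (\<exists>x\<in>Vs. weighted_degree d (fn x) \<and> P = fn x)"
  using V_imp_fn fn_in_V_iff by (auto simp: V_deg_def)

lemma fn_add: "fn x + fn y = fn (x + y)" and fscale_fn: "fscale c (fn x) = fn (Cn c * x)"
  and fn_zero: "fn 0 = 0"
  by (auto simp: fscale_def)

lemma subspace_V_deg: "module.subspace fscale (V_deg d)"
proof -
  interpret vector_space fscale by (rule vector_space_fscale)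
  show ?thesis
  proof (rule subspaceI)
    show "0 \<in> V_deg d"
      unfolding V_deg_iff fn_zero[symmetric] using zero_in_Vs by (force simp: weighted_degree_def)
    show "P + Q \<in> V_deg d" if PQ: "P \<in> V_deg d" "Q \<in> V_deg d" for P Q
    proof -
      obtain x y where xy: "x \<in> Vs" "weighted_degree d (fn x)" "P = fn x"
        "y \<in> Vs" "weighted_degree d (fn y)" "Q = fn y"
        using PQ unfolding V_deg_iff by blast
      then have "weighted_degree d (fn (x + y))" by (simp add: weighted_degree_def distrib_left)
      then show ?thesis
        using xy add_in_Vs[of x y] unfolding V_deg_iff by (auto simp only: fn_add)
    qed
    show "fscale c P \<in> V_deg d" if PQ: "P \<in> V_deg d" for c P
    proof -
      obtain x where x: "x \<in> Vs" "weighted_degree d (fn x)" "P = fn x"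
        using PQ unfolding V_deg_iff by blast
      then have "weighted_degree d (fn (Cn c * x))" by (simp add: weighted_degree_def)
      then show ?thesis
        using x scale_in_Vs[of x c] unfolding V_deg_iff by (auto simp only: fscale_fn)
    qed
  qed
qed

text \<open>A linear functional with trivial kernel on the graded piece, nonzero at
  \<open>g\<close>, identifies that piece with the complex numbers; surjectivity comes from
  multiples of \<open>g\<close>.\<close>

lemma V_deg_line:
  assumes ell: "\<And>x y. ell (x + y) = ell x + ell y" "\<And>c x. ell (Cn c * x) = c * ell x"
    and inj: "\<And>x. x \<in> Vs \<Longrightarrow> weighted_degree d (fn x) \<Longrightarrow> ell x = 0 \<Longrightarrow> x = 0"
    and g: "g \<in> Vs" "weighted_degree d (fn g)" "ell g \<noteq> 0"
  shows "lin_iso fscale (*) (V_deg d) (UNIV :: complex set)"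
proof -
  interpret f: vector_space fscale by (rule vector_space_fscale)
  define phi where "phi P = ell (Smf P)" for P
  have phi: "phi (fn x) = ell x" for x by (simp add: phi_def fn_inverse)
  have "inj_on phi (V_deg d)"
  proof (rule inj_onI)
    fix P Q assume PQ: "P \<in> V_deg d" "Q \<in> V_deg d" "phi P = phi Q"
    then obtain x y where xy: "P = fn x" "Q = fn y" unfolding V_deg_iff by blast
    have "P + fscale (- 1) Q \<in> V_deg d"
      by (intro f.subspace_add f.subspace_scale subspace_V_deg PQ)
    then have "fn (x + Cn (- 1) * y) \<in> V_deg d" by (simp only: xy fscale_fn fn_add)
    then have "x + Cn (- 1) * y \<in> Vs" "weighted_degree d (fn (x + Cn (- 1) * y))"
      by (simp_all only: V_deg_def mem_Collect_eq fn_in_V_iff)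
    moreover have "ell (x + Cn (- 1) * y) = 0"
      using PQ(3) by (simp only: ell phi xy) simp
    ultimately have "x + Cn (- 1) * y = 0" by (rule inj)
    then show "P = Q" by (simp add: xy Cn_hom)
  qed
  moreover have "c \<in> phi ` V_deg d" for c
  proof
    show "c = phi (fn (Cn (c / ell g) * g))" by (simp only: phi ell) (simp add: g(3))
    have "fn g \<in> V_deg d" using g V_deg_iff by blast
    then show "fn (Cn (c / ell g) * g) \<in> V_deg d"
      unfolding fscale_fn[symmetric] by (rule f.subspace_scale[OF subspace_V_deg])
  qed
  ultimately have "bij_betw phi (V_deg d) UNIV" by (auto simp: bij_betw_def)
  moreover have "phi (P + Q) = phi P + phi Q" if "P \<in> V_deg d" "Q \<in> V_deg d" for P Q
    using that unfolding V_deg_iff by (auto simp: fn_add phi ell simp del: plus_smf.rep_eq)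
  moreover have "phi (fscale c P) = c * phi P" if "P \<in> V_deg d" for c P
    using that unfolding V_deg_iff by (auto simp: fscale_fn phi ell simp del: times_smf.rep_eq)
  moreover have "module.subspace ((*) :: complex \<Rightarrow> complex \<Rightarrow> complex) UNIV"
    by (simp add: module.subspace_def module_iff_vector_space vector_space_complex)
  ultimately show ?thesis
    unfolding lin_iso_def using subspace_V_deg by blast
qed

lemma conj_V_deg: "conj_fun ` V_deg d = V_deg (- d)"
proof -
  have sub: "conj_fun ` V_deg d \<subseteq> V_deg (- d)" for d
  proof
    fix P assume "P \<in> conj_fun ` V_deg d"
    then obtain Q where "Q \<in> V_deg d" and P: "P = conj_fun Q" by blast
    then obtain x where "x \<in> Vs" "weighted_degree d (fn x)" "Q = fn x"
      unfolding V_deg_iff by blast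
    moreover from this P have "P = fn (cj x)" by (simp only: conj_fun_fn)
    ultimately show "P \<in> V_deg (- d)"
      unfolding V_deg_iff using cj_in_Vs weighted_degree_cj by blast
  qed
  have "P \<in> conj_fun ` V_deg d" if "P \<in> V_deg (- d)" for P
  proof
    show "P = conj_fun (conj_fun P)" by (simp add: conj_fun_def)
    show "conj_fun P \<in> V_deg d" using sub[of "- d"] that by auto
  qed
  with sub show ?thesis by blast
qed

lemma V_deg_pos_line:
  assumes "ev 0 (wd (Du k) (Gs $ Suc k)) \<noteq> 0"
  shows "lin_iso fscale (*) (V_deg (int k + 1)) (UNIV :: complex set)"
proof (rule V_deg_line[where ell = "\<lambda>x. ev 0 (wd (Du k) x)" and g = "Gs $ Suc k"])
  show "x = 0" if "x \<in> Vs" "weighted_degree (int k + 1) (fn x)" "ev 0 (wd (Du k) x) = 0" for x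
    by (rule V_degree_injective[OF that(1,2)]) (use that(3) in auto)
  show "weighted_degree (int k + 1) (fn (Gs $ Suc k))"
    using Gs_weighted_degree[of "Suc k"] by (simp add: add.commute)
qed (use assms Gs_in_Vs in auto)

theorem theorem8p1:
  "lin_iso fscale (*) (V_deg 0) (UNIV :: complex set) \<and>
   (\<forall>k::nat.
      lin_iso fscale (*) (V_deg (6 * int k + 1)) (UNIV :: complex set) \<and>
      V_deg (6 * int k + 3) = {0} \<and>
      lin_iso fscale (*) (V_deg (6 * int k + 5)) (UNIV :: complex set)) \<and>
   (\<forall>d::int. d \<ge> 0 \<longrightarrow> lin_iso fscale fscale (V_deg (- d)) (conj_fun ` V_deg d))"
proof (intro conjI allI impI)
  show "lin_iso fscale (*) (V_deg 0) (UNIV :: complex set)"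
    by (rule V_deg_line[where ell = z_slope and g = rot])
       (auto simp: z_slope_linear rot_in_Vs rot_weighted_degree z_slope_rot intro: V_degree_injective)
  fix k :: nat
  show "lin_iso fscale (*) (V_deg (6 * int k + 1)) (UNIV :: complex set)"
    using V_deg_pos_line[of "6 * k"] Gs_nonzero(1)[of k] by simp
  show "lin_iso fscale (*) (V_deg (6 * int k + 5)) (UNIV :: complex set)"
    using V_deg_pos_line[of "6 * k + 4"] Gs_nonzero(2)[of k] by (simp add: add.commute)
  show "V_deg (6 * int k + 3) = {0}"
  proof
    show "V_deg (6 * int k + 3) \<subseteq> {0}"
    proof
      fix P assume "P \<in> V_deg (6 * int k + 3)"
      then obtain x where "x \<in> Vs" "weighted_degree (6 * int k + 3) (fn x)" and P: "P = fn x"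
        unfolding V_deg_iff by blast
      then have "x = 0" by (intro V_degree_3_mod_6)
      then show "P \<in> {0}" unfolding P by (simp only: fn_zero singletonI)
    qed
    show "{0} \<subseteq> V_deg (6 * int k + 3)"
      using module.subspace_0[OF _ subspace_V_deg] vector_space_fscale
      by (simp add: module_iff_vector_space)
  qed
next
  fix d :: int
  \<comment> \<open>By \<open>conj_V_deg\<close> the two spaces are equal as sets, so the identity
    is an isomorphism.\<close>
  show "lin_iso fscale fscale (V_deg (- d)) (conj_fun ` V_deg d)"
    unfolding conj_V_deg lin_iso_def using subspace_V_deg bij_betw_id
    by (intro conjI exI[of _ id]) auto
qed

end
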